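(* Let $n\in\mathbb N$ and let $\psi\in\mathcal M(H^n_{2,\rho}(T_\Omega))$. Then $M_\psi$ is a bounded operator on $H^n_{2,\rho}(T_\Omega)$. Moreover, for every $w\in T_\Omega$, $$M_\psi^*K_w^{(n,\rho)}=\overline{\psi(w)}\,K_w^{(n,\rho)}.$$ Consequently, $$|\psi(w)|\le\|M_\psi\|,\qquad w\in T_\Omega,$$ and in particular $\psi\in H^\infty(T_\Omega)$ with $\|\psi\|_{H^\infty(T_\Omega)}\le\|M_\psi\|$.
   Context: Let $d\ge 1$ and let $\Omega\subset\mathbb R^d$ be a nonempty open convex cone containing no complete straight line. Its dual cone is $\Omega^\ast=\{\xi\in\mathbb R^d:\langle x,\xi\rangle\ge 0\text{ for all }x\in\Omega\}$, and $T_\Omega=\mathbb R^d+i\Omega\subset\mathbb C^d$ is the associated tube domain; $H(T_\Omega)$ is the space of holomorphic functions on $T_\Omega$, and $H^\infty(T_\Omega)$ the space of bounded ones with the supremum norm. For $z\in\mathbb C^d$, $\xi\in\mathbb R^d$, $\langle z,\xi\rangle=\sum_{j=1}^d z_j\xi_j$ (bilinear). Fix a continuous function $\rho:\Omega^\ast\to[0,\infty)$ with $\rho(\xi)>0$ for $\xi\ne 0$ and $\rho(t\xi)=t\rho(\xi)$ for all $t>0$, $\xi\in\Omega^\ast$ (so $\rho(0)=0$). For $n\in\mathbb N$ let $w_n(\xi)=\sum_{k=0}^n\rho(\xi)^{2k}$, and let $L^2(\Omega^\ast,w_n)$ be the space of (classes of) measurable complex functions $f$ on $\Omega^\ast$ with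 $\|f\|_{L^2(\Omega^\ast,w_n)}^2=\int_{\Omega^\ast}|f|^2w_n\,d\xi<\infty$. The Hilbertian Hardy--Sobolev space $H^n_{2,\rho}(T_\Omega)$ consists of all holomorphic functions on $T_\Omega$ of the form $\mathcal Lf(z)=\int_{\Omega^\ast}e^{i\langle z,\xi\rangle}f(\xi)\,d\xi$ with $f\in L^2(\Omega^\ast,w_n)$. The map $\mathcal L$ is injective on $L^2(\Omega^\ast,w_n)$, and $H^n_{2,\rho}(T_\Omega)$ is a Hilbert space with inner product $\langle\mathcal Lf,\mathcal Lg\rangle=\int_{\Omega^\ast}f\overline g\,w_n\,d\xi$. Point evaluations at points of $T_\Omega$ are bounded on it. For $w\in T_\Omega$, $K^{(n,\rho)}_w\in H^n_{2,\rho}(T_\Omega)$ denotes the unique function with $F(w)=\langle F,K^{(n,\rho)}_w\rangle$ for all $F\in H^n_{2,\rho}(T_\Omega)$. The multiplier algebra is $\mathcal M(H^n_{2,\rho}(T_\Omega))=\{\psi\in H(T_\Omega):\psi F\in H^n_{2,\rho}(T_\Omega)\text{ for all }F\in H^n_{2,\rho}(T_\Omega)\}$, and for such $\psi$ the multiplication operator is $M_\psi F=\psi F$; $M_\psi^*$ is its Hilbert space adjoint and $\|M_\psi\|$ its operator norm. *)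

theory Defs
  imports "HOL-Analysis.Analysis"
begin

(* The library predicates cone and conic allow the factor 0, so the only nonempty open set
   satisfying them is UNIV; hence the factor is required to be positive here. *)
definition open_convex_cone :: "(real ^ 'd) set \<Rightarrow> bool" where
  "open_convex_cone \<Omega> \<longleftrightarrow>
     open \<Omega> \<and> convex \<Omega> \<and> \<Omega> \<noteq> {} \<and> (\<forall>x\<in>\<Omega>. \<forall>t>0. t *\<^sub>R x \<in> \<Omega>)"

definition contains_line :: "(real ^ 'd) set \<Rightarrow> bool" where
  "contains_line S \<longleftrightarrow> (\<exists>a v. v \<noteq> 0 \<and> (\<forall>t::real. a + t *\<^sub>R v \<in> S))"

definition dual_cone :: "(real ^ 'd) set \<Rightarrow> (real ^ 'd) set" where
  "dual_cone \<Omega> = {\<xi>. \<forall>x\<in>\<Omega>. 0 \<le> x \<bullet> \<xi>}"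

definition tube :: "(real ^ 'd) set \<Rightarrow> (complex ^ 'd) set" where
  "tube \<Omega> = {z. (\<chi> j. Im (z $ j)) \<in> \<Omega>}"

definition pairing :: "complex ^ 'd \<Rightarrow> real ^ 'd \<Rightarrow> complex" where
  "pairing z \<xi> = (\<Sum>j\<in>UNIV. z $ j * complex_of_real (\<xi> $ j))"

(* Complex Frechet differentiability: the real derivative is complex-linear. *)
definition holomorphic_sev :: "(complex ^ 'd \<Rightarrow> complex) \<Rightarrow> (complex ^ 'd) set \<Rightarrow> bool" where
  "holomorphic_sev F S \<longleftrightarrow>
     (\<forall>z\<in>S. \<exists>a. (F has_derivative (\<lambda>h. \<Sum>j\<in>UNIV. a $ j * h $ j)) (at z within S))"

definition weight :: "(real ^ 'd \<Rightarrow> real) \<Rightarrow> nat \<Rightarrow> real ^ 'd \<Rightarrow> real" where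
  "weight \<rho> n \<xi> = (\<Sum>k=0..n. \<rho> \<xi> ^ (2 * k))"

(* Representatives rather than almost-everywhere classes. *)
definition L2w :: "(real ^ 'd) set \<Rightarrow> (real ^ 'd \<Rightarrow> real) \<Rightarrow> nat \<Rightarrow> (real ^ 'd \<Rightarrow> complex) set" where
  "L2w \<Omega> \<rho> n =
     {f. f \<in> borel_measurable (lebesgue_on (dual_cone \<Omega>)) \<and>
         integrable (lebesgue_on (dual_cone \<Omega>)) (\<lambda>\<xi>. (cmod (f \<xi>))\<^sup>2 * weight \<rho> n \<xi>)}"

definition Laplace :: "(real ^ 'd) set \<Rightarrow> (real ^ 'd \<Rightarrow> complex) \<Rightarrow> complex ^ 'd \<Rightarrow> complex" where
  "Laplace \<Omega> f z = (LINT \<xi>|lebesgue_on (dual_cone \<Omega>). exp (\<i> * pairing z \<xi>) * f \<xi>)"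

(* A function on the tube is represented by its extension by zero, so that equality of
   elements of HS is equality of functions and HS is closed under pointwise operations. *)
definition HS :: "(real ^ 'd) set \<Rightarrow> (real ^ 'd \<Rightarrow> real) \<Rightarrow> nat \<Rightarrow> (complex ^ 'd \<Rightarrow> complex) set" where
  "HS \<Omega> \<rho> n =
     {F. holomorphic_sev F (tube \<Omega>) \<and> (\<forall>z. z \<notin> tube \<Omega> \<longrightarrow> F z = 0) \<and>
         (\<exists>f\<in>L2w \<Omega> \<rho> n. \<forall>z\<in>tube \<Omega>. F z = Laplace \<Omega> f z)}"

(* The density of F is unique up to null sets because the transform is injective,
   so HS_inner does not depend on the choice. *)
definition HS_density ::
  "(real ^ 'd) set \<Rightarrow> (real ^ 'd \<Rightarrow> real) \<Rightarrow> nat \<Rightarrow> (complex ^ 'd \<Rightarrow> complex) \<Rightarrow> real ^ 'd \<Rightarrow> complex" where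
  "HS_density \<Omega> \<rho> n F = (SOME f. f \<in> L2w \<Omega> \<rho> n \<and> (\<forall>z\<in>tube \<Omega>. F z = Laplace \<Omega> f z))"

definition HS_inner ::
  "(real ^ 'd) set \<Rightarrow> (real ^ 'd \<Rightarrow> real) \<Rightarrow> nat \<Rightarrow> (complex ^ 'd \<Rightarrow> complex) \<Rightarrow>
   (complex ^ 'd \<Rightarrow> complex) \<Rightarrow> complex" where
  "HS_inner \<Omega> \<rho> n F G =
     (LINT \<xi>|lebesgue_on (dual_cone \<Omega>).
        HS_density \<Omega> \<rho> n F \<xi> * cnj (HS_density \<Omega> \<rho> n G \<xi>) * complex_of_real (weight \<rho> n \<xi>))"

definition HS_norm ::
  "(real ^ 'd) set \<Rightarrow> (real ^ 'd \<Rightarrow> real) \<Rightarrow> nat \<Rightarrow> (complex ^ 'd \<Rightarrow> complex) \<Rightarrow> real" where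
  "HS_norm \<Omega> \<rho> n F = sqrt (Re (HS_inner \<Omega> \<rho> n F F))"

definition HS_kernel ::
  "(real ^ 'd) set \<Rightarrow> (real ^ 'd \<Rightarrow> real) \<Rightarrow> nat \<Rightarrow> complex ^ 'd \<Rightarrow> complex ^ 'd \<Rightarrow> complex" where
  "HS_kernel \<Omega> \<rho> n w = (THE K. K \<in> HS \<Omega> \<rho> n \<and> (\<forall>F\<in>HS \<Omega> \<rho> n. F w = HS_inner \<Omega> \<rho> n F K))"

definition HS_bounded_operator ::
  "(real ^ 'd) set \<Rightarrow> (real ^ 'd \<Rightarrow> real) \<Rightarrow> nat \<Rightarrow>
   ((complex ^ 'd \<Rightarrow> complex) \<Rightarrow> complex ^ 'd \<Rightarrow> complex) \<Rightarrow> bool" where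
  "HS_bounded_operator \<Omega> \<rho> n A \<longleftrightarrow>
     (\<forall>F\<in>HS \<Omega> \<rho> n. A F \<in> HS \<Omega> \<rho> n) \<and>
     (\<forall>F\<in>HS \<Omega> \<rho> n. \<forall>G\<in>HS \<Omega> \<rho> n. A (\<lambda>z. F z + G z) = (\<lambda>z. A F z + A G z)) \<and>
     (\<forall>c. \<forall>F\<in>HS \<Omega> \<rho> n. A (\<lambda>z. c * F z) = (\<lambda>z. c * A F z)) \<and>
     (\<exists>C. \<forall>F\<in>HS \<Omega> \<rho> n. HS_norm \<Omega> \<rho> n (A F) \<le> C * HS_norm \<Omega> \<rho> n F)"

definition HS_opnorm ::
  "(real ^ 'd) set \<Rightarrow> (real ^ 'd \<Rightarrow> real) \<Rightarrow> nat \<Rightarrow>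
   ((complex ^ 'd \<Rightarrow> complex) \<Rightarrow> complex ^ 'd \<Rightarrow> complex) \<Rightarrow> real" where
  "HS_opnorm \<Omega> \<rho> n A = (SUP F\<in>{F \<in> HS \<Omega> \<rho> n. HS_norm \<Omega> \<rho> n F \<le> 1}. HS_norm \<Omega> \<rho> n (A F))"

definition HS_adjoint ::
  "(real ^ 'd) set \<Rightarrow> (real ^ 'd \<Rightarrow> real) \<Rightarrow> nat \<Rightarrow>
   ((complex ^ 'd \<Rightarrow> complex) \<Rightarrow> complex ^ 'd \<Rightarrow> complex) \<Rightarrow>
   (complex ^ 'd \<Rightarrow> complex) \<Rightarrow> complex ^ 'd \<Rightarrow> complex" where
  "HS_adjoint \<Omega> \<rho> n A G =
     (THE H. H \<in> HS \<Omega> \<rho> n \<and> (\<forall>F\<in>HS \<Omega> \<rho> n. HS_inner \<Omega> \<rho> n (A F) G = HS_inner \<Omega> \<rho> n F H))"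

definition mult_op ::
  "(complex ^ 'd \<Rightarrow> complex) \<Rightarrow> (complex ^ 'd \<Rightarrow> complex) \<Rightarrow> complex ^ 'd \<Rightarrow> complex" where
  "mult_op \<psi> F = (\<lambda>z. \<psi> z * F z)"

(* The values of a multiplier, or of an element of Hinf, outside the tube are irrelevant. *)
definition multipliers ::
  "(real ^ 'd) set \<Rightarrow> (real ^ 'd \<Rightarrow> real) \<Rightarrow> nat \<Rightarrow> (complex ^ 'd \<Rightarrow> complex) set" where
  "multipliers \<Omega> \<rho> n =
     {\<psi>. holomorphic_sev \<psi> (tube \<Omega>) \<and> (\<forall>F\<in>HS \<Omega> \<rho> n. mult_op \<psi> F \<in> HS \<Omega> \<rho> n)}"

definition Hinf :: "(real ^ 'd) set \<Rightarrow> (complex ^ 'd \<Rightarrow> complex) set" where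
  "Hinf \<Omega> = {\<psi>. holomorphic_sev \<psi> (tube \<Omega>) \<and> bounded (\<psi> ` tube \<Omega>)}"

definition Hinf_norm :: "(real ^ 'd) set \<Rightarrow> (complex ^ 'd \<Rightarrow> complex) \<Rightarrow> real" where
  "Hinf_norm \<Omega> \<psi> = (SUP z\<in>tube \<Omega>. cmod (\<psi> z))"

end

theory Submission
  imports Defs
begin

text \<open>
  On a reproducing kernel Hilbert space with kernels \<open>k\<^sub>w\<close> the assertion is soft. Norm convergence
  implies pointwise convergence, so a multiplication operator \<open>M\<close> that maps the space into itself has a
  closed graph and is bounded (\<open>closed_graph_bounded\<close>, \<open>multiplier_bounded\<close>). From
  \<open>\<langle>M F, k\<^sub>w\<rangle> = \<psi> w * F w = \<langle>F, cnj (\<psi> w) k\<^sub>w\<rangle>\<close> the kernel \<open>k\<^sub>w\<close> is an eigenvector of the adjoint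
  (\<open>adjoint_kernel\<close>), and applying \<open>M\<close> to the normalised kernel bounds \<open>|\<psi> w|\<close> by the operator norm,
  provided that \<open>k\<^sub>w\<close> is not zero (\<open>multiplier_value_le\<close>).

  What has to be shown about the Hardy--Sobolev space is that it is such a space. An interior point
  \<open>y\<close> of the cone satisfies \<open>\<langle>y, \<xi>\<rangle> \<ge> c |\<xi>|\<close> on the dual cone (\<open>dual_cone_coercive\<close>); this exponential
  decay makes all Laplace integrals converge, gives holomorphy of the transforms
  (\<open>holomorphic_Laplace\<close>), and shows that \<open>exp (- i \<langle>cnj w, \<xi>\<rangle>) / w\<^sub>n \<xi>\<close> is the square integrable density of the
  reproducing kernel at \<open>w\<close>. Completeness is the Riesz--Fischer argument (\<open>L2_complete\<close>).

  The inner product is defined through densities, so it is well defined only because the Laplace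
  transform is injective (\<open>Laplace_zero_imp_AE_zero\<close>). On imaginary points the transform tests a density
  against the functions \<open>exp (- \<langle>y, \<xi>\<rangle>)\<close> with \<open>y\<close> in the cone. These are closed under multiplication and
  separate points, so the Stone--Weierstrass theorem applies after embedding the dual cone into a cube.

  Finally, the cone contains no line, so its dual cone is not contained in a hyperplane and has positive
  measure (\<open>dual_cone_not_negligible\<close>). Hence no kernel function is zero (\<open>kernel_norm_pos\<close>).
\<close>

section \<open>The closed graph theorem for spaces of functions\<close>

text \<open>A Banach space of functions, its carrier and norm given explicitly because the spaces to which
  it applies depend on parameters. Completeness is required for sequences with geometrically small
  increments; every Cauchy sequence has such a subsequence, so this is the usual notion.\<close>

locale complete_function_space =
  fixes V :: "('a \<Rightarrow> complex) set" and nm :: "('a \<Rightarrow> complex) \<Rightarrow> real"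
  assumes zero_mem: "(\<lambda>x. 0) \<in> V"
    and add_mem: "\<And>F G. F \<in> V \<Longrightarrow> G \<in> V \<Longrightarrow> (\<lambda>x. F x + G x) \<in> V"
    and scale_mem: "\<And>c F. F \<in> V \<Longrightarrow> (\<lambda>x. c * F x) \<in> V"
    and nm_nonneg: "\<And>F. F \<in> V \<Longrightarrow> 0 \<le> nm F"
    and nm_triangle: "\<And>F G. F \<in> V \<Longrightarrow> G \<in> V \<Longrightarrow> nm (\<lambda>x. F x + G x) \<le> nm F + nm G"
    and nm_scale: "\<And>c F. F \<in> V \<Longrightarrow> nm (\<lambda>x. c * F x) = cmod c * nm F"
    and nm_eq_0: "\<And>F. F \<in> V \<Longrightarrow> nm F = 0 \<Longrightarrow> F = (\<lambda>x. 0)"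
    and complete: "\<And>F C. (\<And>k. F k \<in> V) \<Longrightarrow>
          (\<And>k. nm (\<lambda>x. F (Suc k) x - F k x) \<le> C * (1/2) ^ k) \<Longrightarrow>
          \<exists>G\<in>V. (\<lambda>k. nm (\<lambda>x. F k x - G x)) \<longlonglongrightarrow> 0"
begin

lemma diff_mem: "F \<in> V \<Longrightarrow> G \<in> V \<Longrightarrow> (\<lambda>x. F x - G x) \<in> V"
  using add_mem[of F "\<lambda>x. -1 * G x"] scale_mem[of G "-1"] by simp

lemma nm_zero: "nm (\<lambda>x. 0) = 0"
  using nm_scale[OF zero_mem, of 0] by simp

lemma nm_minus_commute:
  assumes "F \<in> V" "G \<in> V"
  shows "nm (\<lambda>x. F x - G x) = nm (\<lambda>x. G x - F x)"
  using nm_scale[OF diff_mem[OF assms], of "-1"] by simp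

lemma nm_diff_triangle:
  assumes "F \<in> V" "G \<in> V" "H \<in> V"
  shows "nm (\<lambda>x. F x - H x) \<le> nm (\<lambda>x. F x - G x) + nm (\<lambda>x. G x - H x)"
  using nm_triangle[OF diff_mem[OF assms(1,2)] diff_mem[OF assms(2,3)]] by simp

lemma nm_le_add_diff:
  assumes "F \<in> V" "G \<in> V"
  shows "nm F \<le> nm G + nm (\<lambda>x. F x - G x)"
  using nm_triangle[OF assms(2) diff_mem[OF assms]] by simp

text \<open>The role of Baire's theorem is played by a direct nested ball argument. If the conclusion failed,
  then near every point there would be a ball on which \<open>A\<close> exceeds any prescribed bound (the point only
  shifts the bound by a constant, as \<open>A\<close> is additive); balls nested inside each other, with bounds
  tending to infinity, would share a point whose image has a norm above every bound.\<close>

lemma bounded_on_dense_subset_of_ball: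
  assumes A_mem: "\<And>F. F \<in> V \<Longrightarrow> A F \<in> V"
    and A_add: "\<And>F G. F \<in> V \<Longrightarrow> G \<in> V \<Longrightarrow> A (\<lambda>x. F x + G x) = (\<lambda>x. A F x + A G x)"
  obtains N :: nat and r where "r > 0"
    "\<And>F e. F \<in> V \<Longrightarrow> nm F < r \<Longrightarrow> e > 0 \<Longrightarrow>
       \<exists>G\<in>V. nm (A G) \<le> real N \<and> nm (\<lambda>x. F x - G x) < e"
proof -
  have "\<exists>N::nat. \<exists>r>0. \<forall>F\<in>V. nm F < r \<longrightarrow> (\<forall>e>0. \<exists>G\<in>V. nm (A G) \<le> real N \<and> nm (\<lambda>x. F x - G x) < e)"
  proof (rule ccontr)
    assume "\<not> ?thesis"
    then have bad: "\<exists>F\<in>V. nm F < r \<and> (\<exists>e>0. \<forall>G\<in>V. nm (\<lambda>x. F x - G x) < e \<longrightarrow> nm (A G) > real N)"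
      if "r > 0" for N :: nat and r
      using that by (meson not_le)
    \<comment> \<open>translation of the assumption to an arbitrary centre \<open>C\<close>\<close>
    have escape: "\<exists>F\<in>V. \<exists>e. e > 0 \<and> e \<le> r \<and> nm (\<lambda>x. C x - F x) + e \<le> r
        \<and> (\<forall>G\<in>V. nm (\<lambda>x. F x - G x) \<le> e \<longrightarrow> nm (A G) > real N)"
      if C: "C \<in> V" and r: "r > 0" for C N r
    proof -
      obtain K :: nat where K: "real N + nm (A C) \<le> real K" using real_arch_simple by blast
      obtain U e where U: "U \<in> V" "nm U < r / 2" "e > 0"
        and Ue: "\<And>G. G \<in> V \<Longrightarrow> nm (\<lambda>x. U x - G x) < e \<Longrightarrow> nm (A G) > real K"
        using bad[of "r/2" K] r by auto
      define F where "F = (\<lambda>x. C x + U x)"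
      define e' where "e' = min (e/2) (r/2)"
      have FV: "F \<in> V" unfolding F_def using C U by (intro add_mem)
      have CF: "nm (\<lambda>x. C x - F x) = nm U"
        using nm_scale[OF U(1), of "-1"] by (simp add: F_def)
      have "nm (A G) > real N" if G: "G \<in> V" "nm (\<lambda>x. F x - G x) \<le> e'" for G
      proof -
        have D: "(\<lambda>x. G x - C x) \<in> V" using G C by (intro diff_mem)
        have "(\<lambda>x. U x - (G x - C x)) = (\<lambda>x. F x - G x)" by (auto simp: F_def)
        then have "nm (\<lambda>x. U x - (G x - C x)) < e" using G(2) U(3) by (simp add: e'_def)
        then have 1: "nm (A (\<lambda>x. G x - C x)) > real K" using Ue[OF D] by simp
        have "A G = (\<lambda>x. A (\<lambda>x. G x - C x) x + A C x)" using A_add[OF D C] by simp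
        then have eq: "A (\<lambda>x. G x - C x) = (\<lambda>x. A G x - A C x)" by (simp add: fun_eq_iff)
        have "nm (\<lambda>x. A G x - A C x) \<le> nm (A G) + nm (A C)"
          using nm_diff_triangle[OF A_mem[OF G(1)] zero_mem A_mem[OF C]]
            nm_minus_commute[OF zero_mem A_mem[OF C]] by simp
        then show ?thesis using 1[unfolded eq] K by linarith
      qed
      moreover have "e' > 0" "e' \<le> r" "nm (\<lambda>x. C x - F x) + e' \<le> r"
        using U r by (auto simp: e'_def CF)
      ultimately show ?thesis using FV by blast
    qed
    define P where "P = (\<lambda>n (F, e). F \<in> V \<and> e > 0 \<and> e \<le> (1/2::real) ^ n \<and>
       (\<forall>G\<in>V. nm (\<lambda>x. F x - G x) \<le> e \<longrightarrow> nm (A G) > real n))"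
    define Q where "Q = (\<lambda>(n::nat) (F, e) (F', e'). nm (\<lambda>x. F x - F' x) + e' \<le> (e::real))"
    have "\<exists>f. \<forall>n. P n (f n) \<and> Q n (f n) (f (Suc n))"
    proof (rule dependent_nat_choice)
      from escape[OF zero_mem, of 1 0] obtain F e where
        "F \<in> V" "e > 0" "e \<le> 1" "\<forall>G\<in>V. nm (\<lambda>x. F x - G x) \<le> e \<longrightarrow> nm (A G) > real 0"
        by (metis zero_less_one)
      then show "\<exists>x. P 0 x" by (intro exI[of _ "(F, e)"]) (simp add: P_def)
    next
      fix s n assume Ps: "P n s"
      obtain C r where s: "s = (C, r)" by force
      have C: "C \<in> V" "r > 0" "r \<le> (1/2) ^ n" using Ps by (auto simp: P_def s)
      define r' where "r' = min r ((1/2) ^ Suc n)"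
      have "r' > 0" using C by (simp add: r'_def)
      from escape[OF C(1) this, of "Suc n"] obtain F e where
        "F \<in> V" "e > 0" "e \<le> r'" "nm (\<lambda>x. C x - F x) + e \<le> r'"
        "\<forall>G\<in>V. nm (\<lambda>x. F x - G x) \<le> e \<longrightarrow> nm (A G) > real (Suc n)" by metis
      then show "\<exists>y. P (Suc n) y \<and> Q n s y"
        by (intro exI[of _ "(F, e)"]) (simp add: P_def Q_def s r'_def)
    qed
    then obtain f where f: "\<And>n. P n (f n)" "\<And>n. Q n (f n) (f (Suc n))" by blast
    define F where "F = (\<lambda>n. fst (f n))"
    define e where "e = (\<lambda>n. snd (f n))"
    have FV: "F n \<in> V" and e: "e n > 0" "e n \<le> (1/2) ^ n"
      and big: "\<And>G. G \<in> V \<Longrightarrow> nm (\<lambda>x. F n x - G x) \<le> e n \<Longrightarrow> nm (A G) > real n" for n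
      using f(1)[of n] by (auto simp: P_def F_def e_def split: prod.splits)
    have step: "nm (\<lambda>x. F n x - F (Suc n) x) + e (Suc n) \<le> e n" for n
      using f(2)[of n] by (auto simp: Q_def F_def e_def split: prod.splits)
    have nested: "nm (\<lambda>x. F n x - F (n + m) x) + e (n + m) \<le> e n" for n m
    proof (induction m)
      case 0 then show ?case by (simp add: nm_zero)
    next
      case (Suc m)
      then show ?case
        using nm_diff_triangle[OF FV[of n] FV[of "n+m"] FV[of "n + Suc m"]] step[of "n+m"] by simp
    qed
    have "nm (\<lambda>x. F (Suc k) x - F k x) \<le> 1 * (1/2) ^ k" for k
      using step[of k] e[of k] e(1)[of "Suc k"] nm_minus_commute[OF FV FV, of k "Suc k"] by linarith
    from complete[OF FV this] obtain G where G: "G \<in> V" "(\<lambda>k. nm (\<lambda>x. F k x - G x)) \<longlonglongrightarrow> 0" by blast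
    have "nm (\<lambda>x. F n x - G x) \<le> e n" for n
    proof (rule field_le_epsilon)
      fix d :: real assume "d > 0"
      from LIMSEQ_D[OF G(2) this] obtain k where "k \<ge> n" "nm (\<lambda>x. F k x - G x) < d"
        by (metis abs_less_iff diff_zero linear real_norm_def)
      then show "nm (\<lambda>x. F n x - G x) \<le> e n + d"
        using nested[of n "k - n"] nm_diff_triangle[OF FV[of n] FV[of k] G(1)] e(1)[of k] by simp
    qed
    then have "real n < nm (A G)" for n using big[OF G(1)] by blast
    then show False using reals_Archimedean2[of "nm (A G)"] by (meson less_asym)
  qed
  then show ?thesis using that by blast
qed

text \<open>Correcting the error of each approximation on half the scale turns the bound on a dense subset
  of the ball into a convergent series; closedness of the graph identifies its image.\<close>

theorem closed_graph_bounded: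
  assumes A_mem: "\<And>F. F \<in> V \<Longrightarrow> A F \<in> V"
    and A_add: "\<And>F G. F \<in> V \<Longrightarrow> G \<in> V \<Longrightarrow> A (\<lambda>x. F x + G x) = (\<lambda>x. A F x + A G x)"
    and A_scale: "\<And>c F. F \<in> V \<Longrightarrow> A (\<lambda>x. c * F x) = (\<lambda>x. c * A F x)"
    and closed: "\<And>T F H. (\<And>k. T k \<in> V) \<Longrightarrow> F \<in> V \<Longrightarrow> H \<in> V \<Longrightarrow>
       (\<lambda>k::nat. nm (\<lambda>x. T k x - F x)) \<longlonglongrightarrow> 0 \<Longrightarrow> (\<lambda>k. nm (\<lambda>x. A (T k) x - H x)) \<longlonglongrightarrow> 0 \<Longrightarrow> H = A F"
  shows "\<exists>C. \<forall>F\<in>V. nm (A F) \<le> C * nm F"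
proof -
  obtain N :: nat and r where r: "r > 0"
    and approx: "\<And>F e. F \<in> V \<Longrightarrow> nm F < r \<Longrightarrow> e > 0 \<Longrightarrow>
       \<exists>G\<in>V. nm (A G) \<le> real N \<and> nm (\<lambda>x. F x - G x) < e"
    proof (rule bounded_on_dense_subset_of_ball[of A])
    show "\<And>F. F \<in> V \<Longrightarrow> A F \<in> V" by (rule A_mem)
    show "\<And>F G. F \<in> V \<Longrightarrow> G \<in> V \<Longrightarrow> A (\<lambda>x. F x + G x) = (\<lambda>x. A F x + A G x)" by (rule A_add)
  qed (rule that)
  have unit: "nm (A F) \<le> 2 * real N" if F: "F \<in> V" "nm F < r" for F
  proof -
    \<comment> \<open>\<open>T\<close> is the \<open>k\<close>-th partial sum; the error is rescaled to the ball of radius \<open>r\<close>,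
      approximated there, and the approximation is scaled back and added\<close>
    define P where "P = (\<lambda>k T. T \<in> V \<and> nm (\<lambda>x. F x - T x) < r * (1/2) ^ k
        \<and> nm (A T) \<le> 2 * real N * (1 - (1/2) ^ k))"
    define Q where "Q = (\<lambda>k T T'. nm (\<lambda>x. A T' x - A T x) \<le> real N * (1/2) ^ k)"
    have "\<exists>T. \<forall>k. P k (T k) \<and> Q k (T k) (T (Suc k))"
    proof (rule dependent_nat_choice)
      have "A (\<lambda>x. 0) = (\<lambda>x. 0)" using A_scale[OF zero_mem, of 0] by simp
      then show "\<exists>T. P 0 T" using F by (intro exI[of _ "\<lambda>x. 0"]) (simp add: P_def zero_mem nm_zero)
    next
      fix T k assume "P k T"
      then have T: "T \<in> V" "nm (\<lambda>x. F x - T x) < r * (1/2) ^ k"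
        "nm (A T) \<le> 2 * real N * (1 - (1/2) ^ k)" by (auto simp: P_def)
      define W where "W = (\<lambda>x. 2 ^ k * (F x - T x))"
      have W: "W \<in> V" unfolding W_def using F T by (intro scale_mem diff_mem)
      have "nm W = 2 ^ k * nm (\<lambda>x. F x - T x)"
        unfolding W_def using nm_scale[OF diff_mem[OF F(1) T(1)], of "2 ^ k"] by (simp add: norm_power)
      then have "nm W < r" using T(2) by (simp add: field_simps)
      from approx[OF W this, of "r/2"] r obtain G where G: "G \<in> V" "nm (A G) \<le> real N"
        "nm (\<lambda>x. W x - G x) < r / 2" by auto
      define G' where "G' = (\<lambda>x. (1/2) ^ k * G x)"
      define T' where "T' = (\<lambda>x. T x + G' x)"
      have G': "G' \<in> V" unfolding G'_def by (intro scale_mem G)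
      have T': "T' \<in> V" unfolding T'_def by (intro add_mem T G')
      have "(\<lambda>x. F x - T' x) = (\<lambda>x. (1/2) ^ k * (W x - G x))"
        by (auto simp: T'_def G'_def W_def algebra_simps power_one_over simp flip: power_mult_distrib)
      then have "nm (\<lambda>x. F x - T' x) = (1/2) ^ k * nm (\<lambda>x. W x - G x)"
        using nm_scale[OF diff_mem[OF W G(1)], of "(1/2) ^ k"] by (simp add: norm_power norm_divide)
      then have 1: "nm (\<lambda>x. F x - T' x) < r * (1/2) ^ Suc k"
        using mult_strict_left_mono[OF G(3), of "(1/2) ^ k"] by simp
      have AT': "A T' = (\<lambda>x. A T x + A G' x)" unfolding T'_def by (rule A_add[OF T(1) G'])
      have "nm (A G') = (1/2) ^ k * nm (A G)"
        using nm_scale[OF A_mem[OF G(1)], of "(1/2) ^ k"] A_scale[OF G(1), of "(1/2) ^ k"]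
        by (simp add: G'_def norm_power norm_divide)
      then have AG': "nm (A G') \<le> real N * (1/2) ^ k"
        using mult_left_mono[OF G(2), of "(1/2) ^ k"] by (simp add: mult.commute)
      then have "Q k T T'" by (simp add: Q_def AT')
      moreover have "nm (A T') \<le> 2 * real N * (1 - (1/2) ^ Suc k)"
        using nm_triangle[OF A_mem[OF T(1)] A_mem[OF G']] T(3) AG'
        unfolding AT' by (simp add: algebra_simps)
      ultimately show "\<exists>T'. P (Suc k) T' \<and> Q k T T'" using 1 T' by (auto simp: P_def)
    qed
    then obtain T where "\<And>k. P k (T k)" and QT: "\<And>k. Q k (T k) (T (Suc k))" by blast
    then have T: "T k \<in> V" "nm (\<lambda>x. F x - T k x) < r * (1/2) ^ k"
      "nm (A (T k)) \<le> 2 * real N * (1 - (1/2) ^ k)" for k by (auto simp: P_def)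
    have lim0: "(\<lambda>k. r * (1/2) ^ k) \<longlonglongrightarrow> 0"
      by (intro tendsto_mult_right_zero LIMSEQ_power_zero) simp
    have TF: "(\<lambda>k. nm (\<lambda>x. T k x - F x)) \<longlonglongrightarrow> 0"
      using T(2) nm_nonneg[OF diff_mem[OF F(1) T(1)]] nm_minus_commute[OF F(1) T(1)]
      by (intro tendsto_sandwich[OF _ _ tendsto_const lim0] always_eventually allI)
         (auto intro: less_imp_le)
    obtain H where H: "H \<in> V" "(\<lambda>k. nm (\<lambda>x. A (T k) x - H x)) \<longlonglongrightarrow> 0"
      using complete[of "\<lambda>k. A (T k)" "real N"] A_mem[OF T(1)] QT unfolding Q_def by blast
    have AF: "H = A F" using closed[OF T(1) F(1) H(1) TF H(2)] .
    have "nm H \<le> 2 * real N"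
    proof (rule LIMSEQ_le_const)
      show "(\<lambda>k. 2 * real N + nm (\<lambda>x. A (T k) x - H x)) \<longlonglongrightarrow> 2 * real N"
        using tendsto_add[OF tendsto_const H(2), of "2 * real N"] by simp
      have "nm (A (T k)) \<le> 2 * real N" for k
        using T(3)[of k] by (smt (verit) mult_left_le of_nat_0_le_iff zero_le_divide_1_iff zero_le_power)
      then show "\<exists>M. \<forall>k\<ge>M. nm H \<le> 2 * real N + nm (\<lambda>x. A (T k) x - H x)"
        using nm_le_add_diff[OF H(1) A_mem[OF T(1)]] nm_minus_commute[OF H(1) A_mem[OF T(1)]]
        by (smt (verit))
    qed
    then show ?thesis by (simp add: AF)
  qed
  have "nm (A F) \<le> (4 * real N / r) * nm F" if F: "F \<in> V" for F
  proof (cases "nm F = 0")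
    case True
    then have "F = (\<lambda>x. 0)" using nm_eq_0 F by blast
    then have "A F = (\<lambda>x. 0)" using A_scale[OF zero_mem, of 0] by simp
    then show ?thesis by (simp add: True nm_zero)
  next
    case False
    then have pos: "nm F > 0" using nm_nonneg[OF F] by simp
    define t where "t = r / (2 * nm F)"
    have t: "t > 0" using r pos by (simp add: t_def)
    have "nm (\<lambda>x. complex_of_real t * F x) = t * nm F" using nm_scale[OF F] t by simp
    also have "\<dots> < r" using r pos by (simp add: t_def)
    finally have "nm (A (\<lambda>x. complex_of_real t * F x)) \<le> 2 * real N" by (intro unit scale_mem F)
    then have "t * nm (A F) \<le> 2 * real N" using A_scale[OF F] nm_scale[OF A_mem[OF F]] t by simp
    then show ?thesis using r pos by (simp add: t_def field_simps)
  qed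
  then show ?thesis by blast
qed

end

section \<open>Multipliers of a reproducing kernel Hilbert space\<close>

text \<open>Functions vanish outside \<open>X\<close>, so that a function in the space is determined by its values on \<open>X\<close>
  and the reproducing property makes the inner product definite.\<close>

locale reproducing_kernel_space =
  fixes X :: "'a set" and V :: "('a \<Rightarrow> complex) set"
    and ip :: "('a \<Rightarrow> complex) \<Rightarrow> ('a \<Rightarrow> complex) \<Rightarrow> complex"
    and k :: "'a \<Rightarrow> 'a \<Rightarrow> complex"
  assumes zero_mem: "(\<lambda>x. 0) \<in> V"
    and add_mem: "\<And>F G. F \<in> V \<Longrightarrow> G \<in> V \<Longrightarrow> (\<lambda>x. F x + G x) \<in> V"
    and scale_mem: "\<And>c F. F \<in> V \<Longrightarrow> (\<lambda>x. c * F x) \<in> V"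
    and ip_add: "\<And>F G H. F \<in> V \<Longrightarrow> G \<in> V \<Longrightarrow> H \<in> V \<Longrightarrow> ip (\<lambda>x. F x + G x) H = ip F H + ip G H"
    and ip_scale: "\<And>c F H. F \<in> V \<Longrightarrow> H \<in> V \<Longrightarrow> ip (\<lambda>x. c * F x) H = c * ip F H"
    and ip_cnj: "\<And>F G. F \<in> V \<Longrightarrow> G \<in> V \<Longrightarrow> ip G F = cnj (ip F G)"
    and ip_nonneg: "\<And>F. F \<in> V \<Longrightarrow> 0 \<le> Re (ip F F)"
    and support: "\<And>F x. F \<in> V \<Longrightarrow> x \<notin> X \<Longrightarrow> F x = 0"
    and kernel_mem: "\<And>w. w \<in> X \<Longrightarrow> k w \<in> V"
    and reproducing: "\<And>w F. w \<in> X \<Longrightarrow> F \<in> V \<Longrightarrow> F w = ip F (k w)"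
    and complete_ip: "\<And>F C. (\<And>k. F k \<in> V) \<Longrightarrow>
          (\<And>k. sqrt (Re (ip (\<lambda>x. F (Suc k) x - F k x) (\<lambda>x. F (Suc k) x - F k x))) \<le> C * (1/2) ^ k) \<Longrightarrow>
          \<exists>G\<in>V. (\<lambda>k. sqrt (Re (ip (\<lambda>x. F k x - G x) (\<lambda>x. F k x - G x)))) \<longlonglongrightarrow> 0"
begin

definition nm :: "('a \<Rightarrow> complex) \<Rightarrow> real" where "nm F = sqrt (Re (ip F F))"

lemma ip_scale_right:
  assumes "F \<in> V" "H \<in> V"
  shows "ip F (\<lambda>x. c * H x) = cnj c * ip F H"
  using ip_cnj[OF assms(1) scale_mem[OF assms(2)], of c] ip_scale[OF assms(2,1), of c]
    ip_cnj[OF assms] by (metis complex_cnj_cnj complex_cnj_mult)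

lemma ip_add_right:
  assumes "F \<in> V" "G \<in> V" "H \<in> V"
  shows "ip F (\<lambda>x. G x + H x) = ip F G + ip F H"
  using ip_cnj[OF assms(1) add_mem[OF assms(2,3)]] ip_add[OF assms(2,3,1)]
    ip_cnj[OF assms(1,2)] ip_cnj[OF assms(1,3)] by (metis complex_cnj_cnj complex_cnj_add)

lemma ip_self: "F \<in> V \<Longrightarrow> ip F F = complex_of_real ((nm F)\<^sup>2)"
  using ip_cnj[of F F] ip_nonneg[of F] by (simp add: nm_def complex_eq_iff)

lemma nm_nonneg: "0 \<le> nm F" if "F \<in> V"
  using ip_nonneg[OF that] by (simp add: nm_def)

lemma nm_scale: 
  assumes "F \<in> V" shows "nm (\<lambda>x. c * F x) = cmod c * nm F"
proof -
  have "ip (\<lambda>x. c * F x) (\<lambda>x. c * F x) = (c * cnj c) * ip F F"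
    using assms by (simp add: ip_scale ip_scale_right scale_mem)
  also have "\<dots> = complex_of_real ((cmod c * nm F)\<^sup>2)"
    by (simp add: ip_self assms complex_mult_cnj cmod_def power_mult_distrib)
  finally have "(nm (\<lambda>x. c * F x))\<^sup>2 = (cmod c * nm F)\<^sup>2"
    using ip_self[OF scale_mem[OF assms]] by (simp only: of_real_eq_iff)
  then show ?thesis using nm_nonneg[OF assms] nm_nonneg[OF scale_mem[OF assms]] by simp
qed

lemma nm_add_scaled_sq:
  assumes "F \<in> V" "G \<in> V"
  shows "(nm (\<lambda>x. F x + c * G x))\<^sup>2 = (nm F)\<^sup>2 + 2 * Re (cnj c * ip F G) + (cmod c)\<^sup>2 * (nm G)\<^sup>2"
proof -
  have cG: "(\<lambda>x. c * G x) \<in> V" by (rule scale_mem[OF assms(2)])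
  have S: "(\<lambda>x. F x + c * G x) \<in> V" by (rule add_mem[OF assms(1) cG])
  have "ip (\<lambda>x. F x + c * G x) (\<lambda>x. F x + c * G x)
     = ip F F + ip F (\<lambda>x. c * G x) + (ip (\<lambda>x. c * G x) F + ip (\<lambda>x. c * G x) (\<lambda>x. c * G x))"
    using ip_add[OF assms(1) cG S] ip_add_right[OF assms(1) assms(1) cG] ip_add_right[OF cG assms(1) cG]
    by simp
  also have "ip (\<lambda>x. c * G x) F = cnj (ip F (\<lambda>x. c * G x))" by (rule ip_cnj[OF assms(1) cG])
  finally have "Re (ip (\<lambda>x. F x + c * G x) (\<lambda>x. F x + c * G x))
     = (nm F)\<^sup>2 + 2 * Re (ip F (\<lambda>x. c * G x)) + (nm (\<lambda>x. c * G x))\<^sup>2"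
    by (simp add: ip_self assms(1) cG)
  then show ?thesis
    by (simp add: ip_self S nm_scale assms ip_scale_right power_mult_distrib)
qed

lemma Cauchy_Schwarz:
  assumes "F \<in> V" "G \<in> V"
  shows "cmod (ip F G) \<le> nm F * nm G"
proof (cases "ip F G = 0")
  case True then show ?thesis using nm_nonneg assms by simp
next
  case False
  define b where "b = cmod (ip F G)"
  have b: "b > 0" using False by (simp add: b_def)
  have quad: "0 \<le> (nm F)\<^sup>2 - 2 * t * b + t\<^sup>2 * (nm G)\<^sup>2" for t :: real
  proof -
    \<comment> \<open>a multiple of \<open>ip F G\<close>, so that the cross term of \<open>F + c G\<close> is real and negative\<close>
    define c where "c = - complex_of_real (t / b) * ip F G"
    have "cnj c * ip F G = - complex_of_real (t / b) * (ip F G * cnj (ip F G))"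
      by (simp add: c_def)
    also have "\<dots> = - complex_of_real (t * b)"
      using b by (simp add: complex_norm_square[symmetric] b_def[symmetric] power2_eq_square)
    finally have "Re (cnj c * ip F G) = - (t * b)" by simp
    moreover have "(cmod c)\<^sup>2 = t\<^sup>2" using b
      by (simp add: c_def norm_mult norm_divide b_def[symmetric])
    ultimately show ?thesis using nm_add_scaled_sq[OF assms, of c] by (metis (no_types, lifting) ab_semigroup_mult_class.mult_ac(1) add.commute minus_mult_minus mult_minus_right uminus_add_conv_diff zero_le_power2)
  qed
  have G: "nm G \<noteq> 0"
  proof
    assume "nm G = 0"
    \<comment> \<open>the quadratic in \<open>t\<close> would be affine with negative slope\<close>
    with quad[of "((nm F)\<^sup>2 + 1) / (2 * b)"] b show False by (simp add: field_simps)
  qed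
  have "0 \<le> (nm F)\<^sup>2 - b\<^sup>2 / (nm G)\<^sup>2"
    using quad[of "b / (nm G)\<^sup>2"] G by (simp add: power2_eq_square)
  then have "b\<^sup>2 \<le> (nm F * nm G)\<^sup>2"
    using G by (simp add: divide_le_eq power_mult_distrib)
  then show ?thesis unfolding b_def
    by (rule power2_le_imp_le) (intro mult_nonneg_nonneg nm_nonneg assms)
qed

lemma nm_triangle:
  assumes "F \<in> V" "G \<in> V"
  shows "nm (\<lambda>x. F x + G x) \<le> nm F + nm G"
proof (rule power2_le_imp_le)
  have "Re (ip F G) \<le> nm F * nm G"
    using Cauchy_Schwarz[OF assms] complex_Re_le_cmod[of "ip F G"] by linarith
  then show "(nm (\<lambda>x. F x + G x))\<^sup>2 \<le> (nm F + nm G)\<^sup>2"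
    using nm_add_scaled_sq[OF assms, of 1] by (simp add: power2_sum)
qed (use nm_nonneg assms in auto)

lemma evaluation_bounded: "w \<in> X \<Longrightarrow> F \<in> V \<Longrightarrow> cmod (F w) \<le> nm (k w) * nm F"
  using reproducing[of w F] Cauchy_Schwarz[OF _ kernel_mem, of F w] by (simp add: mult.commute)

lemma nm_eq_0:
  assumes "F \<in> V" "nm F = 0" shows "F = (\<lambda>x. 0)"
proof
  fix x show "F x = 0"
    using evaluation_bounded[of x F] support[of F x] assms by (cases "x \<in> X") auto
qed

sublocale complete_function_space V nm
  by unfold_locales
     (fact zero_mem add_mem scale_mem nm_nonneg nm_triangle nm_scale nm_eq_0
           complete_ip[folded nm_def])+

lemma tendsto_nm_imp_pointwise:
  assumes "\<And>n. T n \<in> V" "F \<in> V" "(\<lambda>n. nm (\<lambda>x. T n x - F x)) \<longlonglongrightarrow> 0" "x \<in> X"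
  shows "(\<lambda>n. T n x) \<longlonglongrightarrow> F x"
proof -
  have "(\<lambda>n. nm (k x) * nm (\<lambda>x. T n x - F x)) \<longlonglongrightarrow> 0"
    using tendsto_mult_right_zero[OF assms(3)] .
  then have "(\<lambda>n. T n x - F x) \<longlonglongrightarrow> 0"
    by (rule Lim_null_comparison[rotated])
       (use evaluation_bounded[OF assms(4) diff_mem[OF assms(1,2)]] in auto)
  then show ?thesis by (rule LIM_zero_cancel)
qed

lemma ip_ext:
  assumes "G \<in> V" "H \<in> V" "\<And>F. F \<in> V \<Longrightarrow> ip F G = ip F H"
  shows "G = H"
proof -
  have D: "(\<lambda>x. G x - H x) \<in> V" by (rule diff_mem[OF assms(1,2)])
  have "ip (\<lambda>x. G x - H x) G = ip (\<lambda>x. G x - H x) (\<lambda>x. G x - H x) + ip (\<lambda>x. G x - H x) H"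
    using ip_add_right[OF D D assms(2)] by simp
  then have "nm (\<lambda>x. G x - H x) = 0" using assms(3)[OF D] by (simp add: nm_def)
  then show ?thesis using nm_eq_0[OF D] by (simp add: fun_eq_iff)
qed

text \<open>Norm convergence implies pointwise convergence, so the graph of a multiplication operator is
  closed.\<close>

theorem multiplier_bounded:
  assumes "\<And>F. F \<in> V \<Longrightarrow> (\<lambda>x. \<psi> x * F x) \<in> V"
  shows "\<exists>C. \<forall>F\<in>V. nm (\<lambda>x. \<psi> x * F x) \<le> C * nm F"
proof (rule closed_graph_bounded)
  fix T F H
  assume *: "\<And>k::nat. T k \<in> V" "F \<in> V" "H \<in> V" "(\<lambda>k. nm (\<lambda>x. T k x - F x)) \<longlonglongrightarrow> 0"
    "(\<lambda>k. nm (\<lambda>x. \<psi> x * T k x - H x)) \<longlonglongrightarrow> 0"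
  show "H = (\<lambda>x. \<psi> x * F x)"
  proof
    fix x
    show "H x = \<psi> x * F x"
    proof (cases "x \<in> X")
      case True
      have "(\<lambda>k. \<psi> x * T k x) \<longlonglongrightarrow> \<psi> x * F x"
        by (intro tendsto_intros tendsto_nm_imp_pointwise *(1,2,4) True)
      moreover have "(\<lambda>k. \<psi> x * T k x) \<longlonglongrightarrow> H x"
        using tendsto_nm_imp_pointwise[of "\<lambda>k x. \<psi> x * T k x" H x] assms * True by blast
      ultimately show ?thesis by (rule LIMSEQ_unique[symmetric])
    qed (use support[OF *(2)] support[OF *(3)] in auto)
  qed
qed (use assms in \<open>auto simp: algebra_simps\<close>)

lemma adjoint_kernel:
  assumes "\<And>F. F \<in> V \<Longrightarrow> (\<lambda>x. \<psi> x * F x) \<in> V" "w \<in> X" "F \<in> V"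
  shows "ip (\<lambda>x. \<psi> x * F x) (k w) = ip F (\<lambda>z. cnj (\<psi> w) * k w z)"
  using reproducing[OF assms(2,3)] reproducing[OF assms(2) assms(1)[OF assms(3)]]
    ip_scale_right[OF assms(3) kernel_mem[OF assms(2)]] by simp

text \<open>Evaluating \<open>\<psi> k\<^sub>w\<close> at \<open>w\<close> gives \<open>\<psi> w |k\<^sub>w|\<^sup>2\<close>, while evaluation at \<open>w\<close> has norm \<open>|k\<^sub>w|\<close>.\<close>

lemma multiplier_value_le:
  assumes "\<And>F. F \<in> V \<Longrightarrow> (\<lambda>x. \<psi> x * F x) \<in> V" "w \<in> X"
  shows "cmod (\<psi> w) * nm (k w) \<le> nm (\<lambda>x. \<psi> x * k w x)"
proof (cases "nm (k w) = 0")
  case True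
  then show ?thesis using nm_nonneg assms kernel_mem by simp
next
  case False
  then have pos: "nm (k w) > 0" using nm_nonneg[OF kernel_mem] assms by fastforce
  have K: "k w \<in> V" by (rule kernel_mem[OF assms(2)])
  have "cmod (\<psi> w) * (nm (k w))\<^sup>2 = cmod (\<psi> w * k w w)"
    using reproducing[OF assms(2) K] ip_self[OF K] by (simp add: norm_mult norm_power)
  also have "\<dots> \<le> nm (k w) * nm (\<lambda>x. \<psi> x * k w x)"
    using evaluation_bounded[OF assms(2) assms(1)[OF K]] .
  finally show ?thesis using pos by (simp add: power2_eq_square mult.left_commute)
qed

end

section \<open>Decay on dual cones\<close>

lemma power_times_exp_bounded:
  fixes x d :: real
  assumes "x \<ge> 0" "d > 0"
  shows "x ^ m * exp (- d * x) \<le> fact m / d ^ m"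
proof -
  have "(\<lambda>n. (d * x) ^ n /\<^sub>R fact n) sums exp (d * x)" by (rule exp_converges)
  then have "(\<Sum>n\<in>{m}. (d * x) ^ n /\<^sub>R fact n) \<le> exp (d * x)"
    using assms sum_le_suminf[of "\<lambda>n. (d * x) ^ n /\<^sub>R fact n" "{m}"] by (auto simp: sums_iff)
  then have "(d * x) ^ m \<le> fact m * exp (d * x)" by (simp add: field_simps)
  then show ?thesis using assms by (simp add: exp_minus field_simps power_mult_distrib)
qed

text \<open>Cutting space into unit shells turns the integral into \<open>\<Sum>k. exp (-c k) vol (ball (k+1))\<close>.\<close>

lemma integrable_exp_minus_norm:
  assumes c: "c > 0"
  shows "integrable lebesgue (\<lambda>\<xi>::'a::euclidean_space. exp (- c * norm \<xi>))"
proof -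
  let ?d = "DIM('a)"
  let ?V = "unit_ball_vol (real ?d)"
  define a where "a = (\<lambda>k::nat. exp (- c * real k) * (?V * (real k + 1) ^ ?d))"
  have a_nonneg: "a k \<ge> 0" for k by (simp add: a_def unit_ball_vol_nonneg)
  have "summable a"
  proof (rule summable_comparison_test)
    let ?B = "?V * exp c * (fact ?d / (c/2) ^ ?d)"
    have "norm (a k) \<le> ?B * exp (- (c/2)) ^ k" for k
    proof -
      have "(real k + 1) ^ ?d * exp (- (c/2) * (real k + 1)) \<le> fact ?d / (c/2) ^ ?d"
        using c by (intro power_times_exp_bounded) auto
      then have "(?V * exp (c/2) * exp (- (c/2)) ^ k) * ((real k + 1) ^ ?d * exp (- (c/2) * (real k + 1)))
          \<le> (?V * exp (c/2) * exp (- (c/2)) ^ k) * (fact ?d / (c/2) ^ ?d)"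
        by (intro mult_left_mono) (auto simp: unit_ball_vol_nonneg)
      also have "\<dots> \<le> (?V * exp c * exp (- (c/2)) ^ k) * (fact ?d / (c/2) ^ ?d)"
        using c by (intro mult_right_mono mult_left_mono) (auto simp: unit_ball_vol_nonneg)
      also have "(?V * exp (c/2) * exp (- (c/2)) ^ k) * ((real k + 1) ^ ?d * exp (- (c/2) * (real k + 1))) = a k"
      proof -
        have "exp (c/2) * exp (- (c/2)) ^ k * exp (- (c/2) * (real k + 1)) = exp (- c * real k)"
          by (simp add: exp_of_nat_mult[symmetric] exp_add[symmetric] field_simps)
        then have "(?V * (real k + 1) ^ ?d) * (exp (c/2) * exp (- (c/2)) ^ k * exp (- (c/2) * (real k + 1))) = a k"
          by (simp add: a_def)
        then show ?thesis by (simp only: mult_ac)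
      qed
      finally show ?thesis using a_nonneg[of k] by (simp add: mult_ac)
    qed
    then show "\<exists>N. \<forall>k\<ge>N. norm (a k) \<le> ?B * exp (- (c/2)) ^ k" by blast
    show "summable (\<lambda>k. ?B * exp (- (c/2)) ^ k)"
      using c by (intro summable_mult summable_geometric) simp
  qed
  have "(\<integral>\<^sup>+ \<xi>. ennreal (exp (- c * norm (\<xi>::'a))) \<partial>lborel)
      \<le> (\<integral>\<^sup>+ \<xi>. (\<Sum>k. ennreal (exp (- c * real k)) * indicator (cball (0::'a) (real k + 1)) \<xi>) \<partial>lborel)"
  proof (rule nn_integral_mono)
    fix \<xi> :: 'a
    define k where "k = nat \<lfloor>norm \<xi>\<rfloor>"
    have k: "real k \<le> norm \<xi>" "norm \<xi> \<le> real k + 1" unfolding k_def by (simp, linarith)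
    have "ennreal (exp (- c * norm \<xi>)) \<le> ennreal (exp (- c * real k)) * indicator (cball 0 (real k + 1)) \<xi>"
      using k c by (simp add: indicator_def)
    also have "\<dots> \<le> (\<Sum>k. ennreal (exp (- c * real k)) * indicator (cball 0 (real k + 1)) \<xi>)"
    proof -
      define g where "g = (\<lambda>k. ennreal (exp (- c * real k)) * indicator (cball 0 (real k + 1)) \<xi>)"
      have "g k \<le> suminf g" using sum_le_suminf[of g "{k}"] by simp
      then show ?thesis unfolding g_def .
    qed
    finally show "ennreal (exp (- c * norm \<xi>)) \<le> (\<Sum>k. ennreal (exp (- c * real k)) * indicator (cball 0 (real k + 1)) \<xi>)" .
  qed
  also have "\<dots> = (\<Sum>k. ennreal (exp (- c * real k)) * emeasure lborel (cball (0::'a) (real k + 1)))"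
    by (subst nn_integral_suminf)
       (auto simp: nn_integral_cmult_indicator intro!: borel_measurable_times_ennreal borel_measurable_indicator)
  also have "\<dots> = (\<Sum>k. ennreal (a k))"
    by (intro suminf_cong) (simp add: emeasure_cball a_def ennreal_mult' unit_ball_vol_nonneg)
  also have "\<dots> = ennreal (\<Sum>k. a k)"
    using \<open>summable a\<close> a_nonneg by (intro suminf_ennreal2) auto
  also have "\<dots> < \<infinity>" by simp
  finally have "integrable lborel (\<lambda>\<xi>::'a. exp (- c * norm \<xi>))"
    by (intro integrableI_bounded) auto
  then show ?thesis by (simp add: integrable_completion)
qed

text \<open>An interior point \<open>y\<close> of the cone remains in it after a small step in the direction \<open>-\<xi>\<close>.\<close>

lemma dual_cone_coercive:
  assumes "open \<Omega>" "y \<in> \<Omega>"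
  obtains c where "c > 0" "\<And>\<xi>. \<xi> \<in> dual_cone \<Omega> \<Longrightarrow> c * norm \<xi> \<le> y \<bullet> \<xi>"
proof -
  obtain e where e: "e > 0" "ball y e \<subseteq> \<Omega>" using assms openE by blast
  have "e/2 * norm \<xi> \<le> y \<bullet> \<xi>" if \<xi>: "\<xi> \<in> dual_cone \<Omega>" for \<xi>
  proof (cases "\<xi> = 0")
    case False
    have "y - (e / (2 * norm \<xi>)) *\<^sub>R \<xi> \<in> ball y e" using e False by (simp add: dist_norm)
    then have "0 \<le> (y - (e / (2 * norm \<xi>)) *\<^sub>R \<xi>) \<bullet> \<xi>" using e \<xi> unfolding dual_cone_def by blast
    moreover have "e / (2 * norm \<xi>) * (\<xi> \<bullet> \<xi>) = e / 2 * norm \<xi>"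
      using False by (simp add: dot_square_norm power2_eq_square)
    ultimately show ?thesis unfolding inner_diff_left inner_scaleR_left by linarith
  qed simp
  then show ?thesis using that e by (meson half_gt_zero)
qed

lemma dual_cone_pos:
  assumes "open S" "x \<in> S" "\<xi> \<noteq> 0" "\<xi> \<in> dual_cone S"
  shows "0 < x \<bullet> \<xi>"
proof -
  obtain c where "c > 0" "c * norm \<xi> \<le> x \<bullet> \<xi>"
    using dual_cone_coercive[OF assms(1,2)] assms(4) by metis
  moreover from this have "c * norm \<xi> > 0" using assms(3) by simp
  ultimately show ?thesis by linarith
qed

lemma convex_dual_cone: "convex (dual_cone S)"
  unfolding convex_def dual_cone_def by (simp add: inner_add_right)

lemma closed_dual_cone: "closed (dual_cone S)"
proof -
  have "dual_cone S = (\<Inter>x\<in>S. {\<xi>. x \<bullet> \<xi> \<ge> 0})" by (auto simp: dual_cone_def)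
  then show ?thesis by (auto intro: closed_halfspace_ge)
qed

text \<open>A convex null set lies in a hyperplane, and a vector orthogonal to the dual cone would span a line
  through every point of the cone.\<close>

lemma dual_cone_not_negligible:
  assumes cone: "open_convex_cone \<Omega>" and no_line: "\<not> contains_line \<Omega>"
  shows "\<not> negligible (dual_cone \<Omega>)"
proof
  have op: "open \<Omega>" "convex \<Omega>" "\<Omega> \<noteq> {}" and scale: "\<And>x t. x \<in> \<Omega> \<Longrightarrow> t > 0 \<Longrightarrow> t *\<^sub>R x \<in> \<Omega>"
    using cone by (auto simp: open_convex_cone_def)
  assume "negligible (dual_cone \<Omega>)"
  then have "interior (dual_cone \<Omega>) = {}"
    using negligible_subset[OF _ interior_subset] open_not_negligible[OF open_interior] by blast
  then obtain v b where v: "v \<noteq> 0" "dual_cone \<Omega> \<subseteq> {x. v \<bullet> x = b}"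
    using empty_interior_subset_hyperplane[OF convex_dual_cone] by metis
  moreover have "0 \<in> dual_cone \<Omega>" by (simp add: dual_cone_def)
  ultimately have "b = 0" by auto
  then have orth: "v \<bullet> \<xi> = 0" if "\<xi> \<in> dual_cone \<Omega>" for \<xi> using v that by auto
  obtain a where a: "a \<in> \<Omega>" using op by blast
  have "a + t *\<^sub>R v \<in> \<Omega>" for t
  proof (rule ccontr)
    assume "a + t *\<^sub>R v \<notin> \<Omega>"
    \<comment> \<open>a functional separating the point from the cone lies in the dual cone, hence is orthogonal to \<open>v\<close>\<close>
    then obtain \<xi> \<beta> where \<xi>: "\<xi> \<noteq> 0" "\<xi> \<bullet> (a + t *\<^sub>R v) \<le> \<beta>" "\<And>x. x \<in> \<Omega> \<Longrightarrow> \<beta> \<le> \<xi> \<bullet> x"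
      using separating_hyperplane_sets[of "{a + t *\<^sub>R v}" \<Omega>] op by auto
    have lower: "\<beta> \<le> s * (\<xi> \<bullet> x)" if "x \<in> \<Omega>" "s > 0" for x s
      using \<xi>(3)[OF scale[OF that]] by simp
    have nonneg: "0 \<le> \<xi> \<bullet> x" if "x \<in> \<Omega>" for x
    proof (rule ccontr)
      assume neg: "\<not> 0 \<le> \<xi> \<bullet> x"
      have "\<beta> \<le> (\<bar>\<beta>\<bar> + 1) / (- (\<xi> \<bullet> x)) * (\<xi> \<bullet> x)"
        using neg by (intro lower that divide_pos_pos) auto
      with neg show False by simp
    qed
    then have dual: "\<xi> \<in> dual_cone \<Omega>" by (simp add: dual_cone_def inner_commute)
    have "\<beta> \<le> 0"
    proof (rule field_le_epsilon)
      fix e :: real assume "e > 0"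
      define s where "s = e / (\<xi> \<bullet> a + 1)"
      have "s > 0" "s * (\<xi> \<bullet> a) \<le> e"
        using nonneg[OF a] \<open>e > 0\<close> by (auto simp: s_def field_simps intro: add_nonneg_pos)
      then show "\<beta> \<le> 0 + e" using lower[OF a] by force
    qed
    then have "\<xi> \<bullet> a \<le> 0" using \<xi>(2) orth[OF dual] by (simp add: inner_add_right inner_commute)
    then show False using dual_cone_pos[OF op(1) a \<xi>(1) dual] by (simp add: inner_commute)
  qed
  then show False using no_line v(1) by (auto simp: contains_line_def)
qed

lemma norm_exp_pairing:
  "cmod (exp (\<i> * pairing z \<xi>)) = exp (- ((\<chi> j. Im (z $ j)) \<bullet> \<xi>))"
  by (simp add: pairing_def inner_vec_def)

lemma pairing_add_left: "pairing (z + h) \<xi> = pairing z \<xi> + pairing h \<xi>"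
  by (simp add: pairing_def ring_distribs sum.distrib)

lemma cmod_pairing_le: "cmod (pairing z \<xi>) \<le> norm z * norm \<xi>"
proof -
  have "cmod (pairing z \<xi>) \<le> (\<Sum>j\<in>UNIV. \<bar>norm (z $ j)\<bar> * \<bar>norm (\<xi> $ j)\<bar>)"
    unfolding pairing_def by (rule order_trans[OF norm_sum]) (simp add: norm_mult)
  also have "\<dots> \<le> norm z * norm \<xi>"
    unfolding norm_vec_def by (rule L2_set_mult_ineq)
  finally show ?thesis .
qed

lemma continuous_on_pairing [continuous_intros]: "continuous_on S (\<lambda>\<xi>. pairing z \<xi>)"
  unfolding pairing_def by (intro continuous_intros)

section \<open>Laplace transforms of weighted square integrable functions\<close>

lemma has_derivative_within_quadratic:
  assumes "bounded_linear D" "\<delta> > 0"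
    and bound: "\<And>y. y \<in> S \<Longrightarrow> norm (y - x) < \<delta> \<Longrightarrow> norm (f y - f x - D (y - x)) \<le> C * (norm (y - x))\<^sup>2"
  shows "(f has_derivative D) (at x within S)"
  unfolding has_derivative_within_alt
proof (intro conjI allI impI)
  fix e :: real assume e: "e > 0"
  define d where "d = min \<delta> (e / (\<bar>C\<bar> + 1))"
  have "norm (f y - f x - D (y - x)) \<le> e * norm (y - x)" if y: "y \<in> S" "norm (y - x) < d" for y
  proof -
    have "C * norm (y - x) \<le> (\<bar>C\<bar> + 1) * norm (y - x)" by (intro mult_right_mono) auto
    also have "\<dots> \<le> e" using y(2) by (simp add: d_def field_simps)
    finally have "C * norm (y - x) * norm (y - x) \<le> e * norm (y - x)" by (intro mult_right_mono) auto
    then show ?thesis using bound[OF y(1)] y(2) by (simp add: d_def power2_eq_square mult.assoc)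
  qed
  moreover have "d > 0" using e assms by (simp add: d_def)
  ultimately show "\<exists>d>0. \<forall>y\<in>S. norm (y - x) < d \<longrightarrow> norm (f y - f x - D (y - x)) \<le> e * norm (y - x)"
    by blast
qed (rule assms)

locale weighted_cone =
  fixes \<Omega> :: "(real ^ 'd) set" and \<rho> :: "real ^ 'd \<Rightarrow> real" and n :: nat
  assumes cone: "open_convex_cone \<Omega>"
    and no_line: "\<not> contains_line \<Omega>"
    and \<rho>_continuous: "continuous_on (dual_cone \<Omega>) \<rho>"
begin

abbreviation "M \<equiv> lebesgue_on (dual_cone \<Omega>)"
abbreviation "wt \<equiv> weight \<rho> n"
abbreviation "L2 \<equiv> L2w \<Omega> \<rho> n"

lemma open_\<Omega>: "open \<Omega>" and add_\<Omega>: "x \<in> \<Omega> \<Longrightarrow> y \<in> \<Omega> \<Longrightarrow> x + y \<in> \<Omega>" and nonempty_\<Omega>: "\<Omega> \<noteq> {}"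
proof -
  have c: "open \<Omega>" "convex \<Omega>" "\<Omega> \<noteq> {}" "\<And>x t. x \<in> \<Omega> \<Longrightarrow> t > 0 \<Longrightarrow> t *\<^sub>R x \<in> \<Omega>"
    using cone by (auto simp: open_convex_cone_def)
  show "open \<Omega>" "\<Omega> \<noteq> {}" by fact+
  assume "x \<in> \<Omega>" "y \<in> \<Omega>"
  then have "(1/2) *\<^sub>R x + (1/2) *\<^sub>R y \<in> \<Omega>" using c(2) by (intro convexD) auto
  from c(4)[OF this, of 2] show "x + y \<in> \<Omega>" by (simp add: scaleR_add_right)
qed

lemma sets_dual_cone [simp, intro]: "dual_cone \<Omega> \<in> sets lebesgue"
  using closed_dual_cone by (metis borel_closed sets_completionI_sets sets_lborel)

lemma continuous_imp_measurable_M: "continuous_on (dual_cone \<Omega>) f \<Longrightarrow> f \<in> borel_measurable M"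
  by (rule continuous_imp_measurable_on_sets_lebesgue) auto

lemma weight_measurable [measurable]: "wt \<in> borel_measurable M"
  unfolding weight_def
  by (intro continuous_imp_measurable_M continuous_intros \<rho>_continuous)

lemma exp_pairing_measurable [measurable]: "(\<lambda>\<xi>. exp (\<i> * pairing z \<xi>)) \<in> borel_measurable M"
  by (intro continuous_imp_measurable_M continuous_intros)

lemma weight_ge_1: "wt \<xi> \<ge> 1"
proof -
  have "(\<Sum>k\<in>{0}. \<rho> \<xi> ^ (2 * k)) \<le> wt \<xi>"
    unfolding weight_def by (intro sum_mono2) auto
  then show ?thesis by simp
qed

lemma weight_nonneg: "wt \<xi> \<ge> 0" using weight_ge_1[of \<xi>] by linarith

lemma integrable_exp_minus_norm_M:
  assumes "c > 0" shows "integrable M (\<lambda>\<xi>. exp (- c * norm \<xi>))"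
  using integrable_mult_indicator[OF sets_dual_cone integrable_exp_minus_norm[OF assms]]
  by (simp add: integrable_restrict_space)

lemma L2_measurable: "f \<in> L2 \<Longrightarrow> f \<in> borel_measurable M"
  and L2_integrable: "f \<in> L2 \<Longrightarrow> integrable M (\<lambda>\<xi>. (cmod (f \<xi>))\<^sup>2 * wt \<xi>)"
  by (auto simp: L2w_def)

lemma L2_zero: "(\<lambda>\<xi>. 0) \<in> L2" by (simp add: L2w_def)

lemma L2_scale: "f \<in> L2 \<Longrightarrow> (\<lambda>\<xi>. c * f \<xi>) \<in> L2"
  by (auto simp: L2w_def norm_mult power_mult_distrib mult.assoc)

lemma L2_add:
  assumes "f \<in> L2" "g \<in> L2" shows "(\<lambda>\<xi>. f \<xi> + g \<xi>) \<in> L2"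
proof -
  note [measurable] = L2_measurable[OF assms(1)] L2_measurable[OF assms(2)]
  have "integrable M (\<lambda>\<xi>. (cmod (f \<xi> + g \<xi>))\<^sup>2 * wt \<xi>)"
  proof (rule Bochner_Integration.integrable_bound)
    show "integrable M (\<lambda>\<xi>. 2 * ((cmod (f \<xi>))\<^sup>2 * wt \<xi>) + 2 * ((cmod (g \<xi>))\<^sup>2 * wt \<xi>))"
      using L2_integrable assms by auto
    have "(cmod (a + b))\<^sup>2 * wt \<xi> \<le> 2 * ((cmod a)\<^sup>2 * wt \<xi>) + 2 * ((cmod b)\<^sup>2 * wt \<xi>)" for a b \<xi>
    proof -
      have "(cmod (a + b))\<^sup>2 \<le> (cmod a + cmod b)\<^sup>2" by (intro power_mono norm_triangle_ineq) auto
      also have "\<dots> \<le> 2 * (cmod a)\<^sup>2 + 2 * (cmod b)\<^sup>2"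
        using zero_le_power2[of "cmod a - cmod b"] by (simp add: power2_sum power2_diff)
      finally show ?thesis using mult_right_mono[OF _ weight_nonneg] by (fastforce simp: algebra_simps)
    qed
    then show "AE \<xi> in M. norm ((cmod (f \<xi> + g \<xi>))\<^sup>2 * wt \<xi>)
        \<le> norm (2 * ((cmod (f \<xi>))\<^sup>2 * wt \<xi>) + 2 * ((cmod (g \<xi>))\<^sup>2 * wt \<xi>))"
      by (intro AE_I2) (smt (verit) mult_nonneg_nonneg real_norm_def weight_nonneg zero_le_power2)
  qed measurable
  then show ?thesis by (simp add: L2w_def)
qed

lemma L2_diff: "f \<in> L2 \<Longrightarrow> g \<in> L2 \<Longrightarrow> (\<lambda>\<xi>. f \<xi> - g \<xi>) \<in> L2"
  using L2_add[of f "\<lambda>\<xi>. -1 * g \<xi>"] L2_scale[of g "-1"] by simp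

lemma two_mult_le_squares: "2 * (x * y) \<le> x\<^sup>2 + y\<^sup>2" for x y :: real
  using zero_le_power2[of "x - y"] by (simp add: power2_diff)

lemma L2_product_integrable:
  assumes "f \<in> L2" "g \<in> L2"
  shows "integrable M (\<lambda>\<xi>. f \<xi> * cnj (g \<xi>) * complex_of_real (wt \<xi>))"
proof (rule Bochner_Integration.integrable_bound)
  note [measurable] = L2_measurable[OF assms(1)] L2_measurable[OF assms(2)]
  show "integrable M (\<lambda>\<xi>. (cmod (f \<xi>))\<^sup>2 * wt \<xi> + (cmod (g \<xi>))\<^sup>2 * wt \<xi>)"
    using L2_integrable assms by auto
  have "cmod a * cmod b * wt \<xi> \<le> (cmod a)\<^sup>2 * wt \<xi> + (cmod b)\<^sup>2 * wt \<xi>" for a b \<xi>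
  proof -
    have "cmod a * cmod b \<le> (cmod a)\<^sup>2 + (cmod b)\<^sup>2"
      using two_mult_le_squares[of "cmod a" "cmod b"] by (smt (verit) mult_nonneg_nonneg norm_ge_zero)
    from mult_right_mono[OF this weight_nonneg] show ?thesis by (simp add: algebra_simps)
  qed
  then show "AE \<xi> in M. norm (f \<xi> * cnj (g \<xi>) * complex_of_real (wt \<xi>))
      \<le> norm ((cmod (f \<xi>))\<^sup>2 * wt \<xi> + (cmod (g \<xi>))\<^sup>2 * wt \<xi>)"
    by (intro AE_I2) (simp add: norm_mult weight_nonneg)
  have [measurable]: "cnj \<in> borel_measurable borel"
    by (intro borel_measurable_continuous_onI continuous_intros)
  show "(\<lambda>\<xi>. f \<xi> * cnj (g \<xi>) * complex_of_real (wt \<xi>)) \<in> borel_measurable M"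
    by measurable
qed

text \<open>The product is at most the sum of the squares of its factors, and the weight is at least 1.\<close>

lemma L2_exp_integrable:
  assumes "f \<in> L2" "c > 0"
  shows "integrable M (\<lambda>\<xi>. exp (- c * norm \<xi>) * cmod (f \<xi>))"
proof (rule Bochner_Integration.integrable_bound)
  note [measurable] = L2_measurable[OF assms(1)]
  have [measurable]: "(\<lambda>\<xi>. exp (- c * norm \<xi>)) \<in> borel_measurable M"
    by (intro continuous_imp_measurable_M continuous_intros)
  show "integrable M (\<lambda>\<xi>. exp (- (2 * c) * norm \<xi>) + (cmod (f \<xi>))\<^sup>2 * wt \<xi>)"
    using L2_integrable assms integrable_exp_minus_norm_M[of "2 * c"] by auto
  have "exp (- c * norm \<xi>) * cmod (f \<xi>) \<le> exp (- (2 * c) * norm \<xi>) + (cmod (f \<xi>))\<^sup>2 * wt \<xi>" for \<xi>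
  proof -
    have "exp (- c * norm \<xi>) * cmod (f \<xi>) \<le> (exp (- c * norm \<xi>))\<^sup>2 + (cmod (f \<xi>))\<^sup>2"
      using two_mult_le_squares[of "exp (- c * norm \<xi>)" "cmod (f \<xi>)"]
      by (smt (verit) mult_nonneg_nonneg norm_ge_zero exp_ge_zero)
    also have "(exp (- c * norm \<xi>))\<^sup>2 = exp (- (2 * c) * norm \<xi>)" by (simp add: exp_double[symmetric])
    also have "(cmod (f \<xi>))\<^sup>2 \<le> (cmod (f \<xi>))\<^sup>2 * wt \<xi>"
      using mult_left_mono[OF weight_ge_1, of "(cmod (f \<xi>))\<^sup>2"] by simp
    finally show ?thesis by simp
  qed
  then show "AE \<xi> in M. norm (exp (- c * norm \<xi>) * cmod (f \<xi>))
      \<le> norm (exp (- (2 * c) * norm \<xi>) + (cmod (f \<xi>))\<^sup>2 * wt \<xi>)"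
    by (intro AE_I2) (smt (verit) mult_nonneg_nonneg norm_ge_zero exp_ge_zero real_norm_def)
  show "(\<lambda>\<xi>. exp (- c * norm \<xi>) * cmod (f \<xi>)) \<in> borel_measurable M" by measurable
qed

lemma tube_decay:
  assumes "z \<in> tube \<Omega>"
  obtains c where "c > 0"
    "\<And>\<xi>. \<xi> \<in> dual_cone \<Omega> \<Longrightarrow> cmod (exp (\<i> * pairing z \<xi>)) \<le> exp (- c * norm \<xi>)"
proof -
  obtain c where c: "c > 0" "\<And>\<xi>. \<xi> \<in> dual_cone \<Omega> \<Longrightarrow> c * norm \<xi> \<le> (\<chi> j. Im (z $ j)) \<bullet> \<xi>"
    using dual_cone_coercive[OF open_\<Omega>] assms unfolding tube_def by blast
  show ?thesis
    using c(2) by (intro that[OF c(1)]) (unfold norm_exp_pairing, simp)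
qed

text \<open>The general factor \<open>g\<close> covers the exponential \<open>exp (i \<langle>z, \<xi>\<rangle>)\<close> and its derivatives in \<open>z\<close>, whose
  polynomial factors are absorbed by giving up part of the decay rate.\<close>

lemma Laplace_integrand_integrable:
  assumes f: "f \<in> L2" and c: "c > 0"
    and decay: "\<And>\<xi>. \<xi> \<in> dual_cone \<Omega> \<Longrightarrow> cmod (g \<xi>) \<le> B * exp (- c * norm \<xi>)"
    and [measurable]: "g \<in> borel_measurable M"
  shows "integrable M (\<lambda>\<xi>. g \<xi> * f \<xi>)"
proof (rule Bochner_Integration.integrable_bound)
  note [measurable] = L2_measurable[OF f]
  show "integrable M (\<lambda>\<xi>. B * (exp (- c * norm \<xi>) * cmod (f \<xi>)))"
    using L2_exp_integrable[OF f c] by simp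
  have "cmod (g \<xi> * f \<xi>) \<le> B * (exp (- c * norm \<xi>) * cmod (f \<xi>))" if "\<xi> \<in> dual_cone \<Omega>" for \<xi>
    using mult_right_mono[OF decay[OF that], of "cmod (f \<xi>)"] by (simp add: norm_mult mult.assoc)
  then show "AE \<xi> in M. norm (g \<xi> * f \<xi>) \<le> norm (B * (exp (- c * norm \<xi>) * cmod (f \<xi>)))"
    by (intro AE_I2) force
  show "(\<lambda>\<xi>. g \<xi> * f \<xi>) \<in> borel_measurable M" by measurable
qed

lemma Laplace_integrable:
  assumes "f \<in> L2" "z \<in> tube \<Omega>"
  shows "integrable M (\<lambda>\<xi>. exp (\<i> * pairing z \<xi>) * f \<xi>)"
proof -
  obtain c where "c > 0" "\<And>\<xi>. \<xi> \<in> dual_cone \<Omega> \<Longrightarrow> cmod (exp (\<i> * pairing z \<xi>)) \<le> exp (- c * norm \<xi>)"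
    using tube_decay[OF assms(2)] by metis
  then show ?thesis by (intro Laplace_integrand_integrable[OF assms(1), where B = 1 and c = c]) auto
qed

lemma Laplace_add:
  assumes "f \<in> L2" "g \<in> L2" "z \<in> tube \<Omega>"
  shows "Laplace \<Omega> (\<lambda>\<xi>. f \<xi> + g \<xi>) z = Laplace \<Omega> f z + Laplace \<Omega> g z"
  unfolding Laplace_def distrib_left
  by (rule Bochner_Integration.integral_add) (intro Laplace_integrable assms)+

lemma Laplace_scale: "Laplace \<Omega> (\<lambda>\<xi>. c * f \<xi>) z = c * Laplace \<Omega> f z"
  unfolding Laplace_def mult.left_commute[of _ c] by simp

lemma Laplace_diff:
  assumes "f \<in> L2" "g \<in> L2" "z \<in> tube \<Omega>"
  shows "Laplace \<Omega> (\<lambda>\<xi>. f \<xi> - g \<xi>) z = Laplace \<Omega> f z - Laplace \<Omega> g z"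
  unfolding Laplace_def right_diff_distrib
  by (rule Bochner_Integration.integral_diff) (intro Laplace_integrable assms)+

text \<open>Differentiation under the integral sign. The second-order Taylor remainder of the exponential,
  \<open>|h|\<^sup>2 |\<xi>|\<^sup>2 exp (|h| |\<xi>|)\<close>, is absorbed by three quarters of the decay rate \<open>c\<close> once
  \<open>|h| < c/2\<close>.\<close>

lemma holomorphic_Laplace:
  assumes f: "f \<in> L2"
  shows "holomorphic_sev (Laplace \<Omega> f) (tube \<Omega>)"
  unfolding holomorphic_sev_def
proof
  fix z assume z: "z \<in> tube \<Omega>"
  obtain c where c: "c > 0"
    and decay: "\<And>\<xi>. \<xi> \<in> dual_cone \<Omega> \<Longrightarrow> cmod (exp (\<i> * pairing z \<xi>)) \<le> exp (- c * norm \<xi>)"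
    using tube_decay[OF z] by metis
  have split_exp: "exp (- c * r) = exp (- (c/2) * r) * exp (- (c/2) * r)" for r :: real
    by (simp add: exp_add[symmetric])
  define a :: "complex ^ 'd"
    where "a = (\<chi> j. LINT \<xi>|M. (\<i> * complex_of_real (\<xi> $ j) * exp (\<i> * pairing z \<xi>)) * f \<xi>)"
  have int_a: "integrable M (\<lambda>\<xi>. (\<i> * complex_of_real (\<xi> $ j) * exp (\<i> * pairing z \<xi>)) * f \<xi>)" for j
  proof (rule Laplace_integrand_integrable[OF f, where B = "fact 1 / (c/2) ^ 1" and c = "c/2"])
    fix \<xi> assume "\<xi> \<in> dual_cone \<Omega>"
    have "cmod (\<i> * complex_of_real (\<xi> $ j) * exp (\<i> * pairing z \<xi>)) \<le> norm \<xi> * exp (- c * norm \<xi>)"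
      unfolding norm_mult using component_le_norm_cart[of \<xi> j] decay[OF \<open>\<xi> \<in> _\<close>]
      by (intro mult_mono) auto
    also have "\<dots> = norm \<xi> ^ 1 * exp (- (c/2) * norm \<xi>) * exp (- (c/2) * norm \<xi>)"
      by (subst split_exp) (simp only: power_one_right mult.assoc)
    also have "\<dots> \<le> fact 1 / (c/2) ^ 1 * exp (- (c/2) * norm \<xi>)"
      using c by (intro mult_right_mono power_times_exp_bounded) auto
    finally show "cmod (\<i> * complex_of_real (\<xi> $ j) * exp (\<i> * pairing z \<xi>))
      \<le> fact 1 / (c/2) ^ 1 * exp (- (c/2) * norm \<xi>)" .
  qed (use c in \<open>auto intro!: continuous_imp_measurable_M continuous_intros\<close>)
  have lin: "(\<lambda>\<xi>. (\<i> * pairing h \<xi> * exp (\<i> * pairing z \<xi>)) * f \<xi>)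
     = (\<lambda>\<xi>. \<Sum>j\<in>UNIV. h $ j * ((\<i> * complex_of_real (\<xi> $ j) * exp (\<i> * pairing z \<xi>)) * f \<xi>))" for h
    by (simp add: pairing_def sum_distrib_left sum_distrib_right mult_ac)
  have int_lin: "integrable M (\<lambda>\<xi>. (\<i> * pairing h \<xi> * exp (\<i> * pairing z \<xi>)) * f \<xi>)" for h
    unfolding lin using int_a by (intro Bochner_Integration.integrable_sum integrable_mult_right) auto
  have D: "(\<Sum>j\<in>UNIV. a $ j * h $ j) = (LINT \<xi>|M. (\<i> * pairing h \<xi> * exp (\<i> * pairing z \<xi>)) * f \<xi>)" for h
    unfolding lin using int_a
    by (subst Bochner_Integration.integral_sum) (auto simp: a_def mult.commute)
  define B where "B = fact 2 / (c/4) ^ 2"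
  define C where "C = (LINT \<xi>|M. B * (exp (- (c/4) * norm \<xi>) * cmod (f \<xi>)))"
  have "(Laplace \<Omega> f has_derivative (\<lambda>h. \<Sum>j\<in>UNIV. a $ j * h $ j)) (at z within tube \<Omega>)"
  proof (rule has_derivative_within_quadratic[where \<delta> = "c/2" and C = C])
    show "bounded_linear (\<lambda>h. \<Sum>j\<in>UNIV. a $ j * h $ j)"
      by (intro bounded_linear_sum bounded_linear_const_mult bounded_linear_vec_nth)
    show "c / 2 > 0" using c by simp
    fix y assume y: "y \<in> tube \<Omega>" "norm (y - z) < c / 2"
    define h where "h = y - z"
    have yz: "y = z + h" by (simp add: h_def)
    define R where "R = (\<lambda>\<xi>. (exp (\<i> * pairing y \<xi>) * f \<xi> - exp (\<i> * pairing z \<xi>) * f \<xi>)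
        - (\<i> * pairing h \<xi> * exp (\<i> * pairing z \<xi>)) * f \<xi>)"
    have int_R: "integrable M R"
      unfolding R_def using Laplace_integrable[OF f] y z int_lin by auto
    have "Laplace \<Omega> f y - Laplace \<Omega> f z - (\<Sum>j\<in>UNIV. a $ j * h $ j) = (LINT \<xi>|M. R \<xi>)"
      unfolding R_def D Laplace_def using Laplace_integrable[OF f] y z int_lin by simp
    also have "cmod \<dots> \<le> (LINT \<xi>|M. (norm h)\<^sup>2 * (B * (exp (- (c/4) * norm \<xi>) * cmod (f \<xi>))))"
    proof (rule Bochner_Integration.integral_norm_bound_integral[OF int_R])
      show "integrable M (\<lambda>\<xi>. (norm h)\<^sup>2 * (B * (exp (- (c/4) * norm \<xi>) * cmod (f \<xi>))))"
        using L2_exp_integrable[OF f, of "c/4"] c by simp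
      fix \<xi> assume "\<xi> \<in> space M"
      then have \<xi>: "\<xi> \<in> dual_cone \<Omega>" by simp
      define u where "u = \<i> * pairing h \<xi>"
      have u: "cmod u \<le> norm h * norm \<xi>" by (simp add: u_def norm_mult cmod_pairing_le)
      have "cmod (exp u - 1 - u) \<le> exp \<bar>Re u\<bar> * cmod u ^ 2"
        using Taylor_exp[of u 1] by (simp add: power2_eq_square diff_diff_add)
      also have "\<dots> \<le> exp (c/2 * norm \<xi>) * (norm h * norm \<xi>) ^ 2"
      proof (intro mult_mono power_mono u)
        have "\<bar>Re u\<bar> \<le> norm h * norm \<xi>" using u abs_Re_le_cmod[of u] by linarith
        also have "\<dots> \<le> c/2 * norm \<xi>" using y(2) by (intro mult_right_mono) (auto simp: h_def)
        finally show "exp \<bar>Re u\<bar> \<le> exp (c/2 * norm \<xi>)" by simp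
      qed auto
      finally have taylor: "cmod (exp u - 1 - u) \<le> exp (c/2 * norm \<xi>) * (norm h * norm \<xi>) ^ 2" .
      have "R \<xi> = exp (\<i> * pairing z \<xi>) * (exp u - 1 - u) * f \<xi>"
        by (simp add: R_def yz u_def pairing_add_left ring_distribs exp_add algebra_simps)
      then have "cmod (R \<xi>) = cmod (exp (\<i> * pairing z \<xi>)) * cmod (exp u - 1 - u) * cmod (f \<xi>)"
        by (simp add: norm_mult)
      also have "\<dots> \<le> exp (- c * norm \<xi>) * (exp (c/2 * norm \<xi>) * (norm h * norm \<xi>) ^ 2) * cmod (f \<xi>)"
        by (intro mult_right_mono mult_mono decay[OF \<xi>] taylor) auto
      also have "\<dots> = (norm h)\<^sup>2 * ((norm \<xi> ^ 2 * exp (- (c/4) * norm \<xi>)) * (exp (- (c/4) * norm \<xi>) * cmod (f \<xi>)))"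
      proof -
        have "exp (- c * norm \<xi>) * exp (c/2 * norm \<xi>) = exp (- (c/4) * norm \<xi>) * exp (- (c/4) * norm \<xi>)"
          by (simp add: exp_add[symmetric])
        then show ?thesis by (simp add: power_mult_distrib mult_ac)
      qed
      also have "\<dots> \<le> (norm h)\<^sup>2 * (B * (exp (- (c/4) * norm \<xi>) * cmod (f \<xi>)))"
        unfolding B_def using c by (intro mult_left_mono mult_right_mono power_times_exp_bounded) auto
      finally show "norm (R \<xi>) \<le> (norm h)\<^sup>2 * (B * (exp (- (c/4) * norm \<xi>) * cmod (f \<xi>)))" .
    qed
    also have "\<dots> = C * (norm h)\<^sup>2" by (simp add: C_def mult.commute)
    finally show "norm (Laplace \<Omega> f y - Laplace \<Omega> f z - (\<Sum>j\<in>UNIV. a $ j * (y - z) $ j)) \<le> C * (norm (y - z))\<^sup>2"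
      by (simp add: h_def)
  qed
  then show "\<exists>a. (Laplace \<Omega> f has_derivative (\<lambda>h. \<Sum>j\<in>UNIV. a $ j * h $ j)) (at z within tube \<Omega>)"
    by blast
qed

end

section \<open>Injectivity of the Laplace transform\<close>

text \<open>By inner regularity the set where \<open>h\<close> is positive is a countable union of compact sets up to a
  null set, and on each of these the integral of \<open>h\<close> vanishes.\<close>

lemma AE_nonpos_if_compact_integrals_zero:
  fixes h :: "'a::euclidean_space \<Rightarrow> real"
  assumes D: "D \<in> sets lebesgue" and h: "integrable (lebesgue_on D) h"
    and zero: "\<And>A. compact A \<Longrightarrow> A \<subseteq> D \<Longrightarrow> (LINT x|lebesgue_on D. indicator A x * h x) = 0"
  shows "AE x in lebesgue_on D. h x \<le> 0"
proof -
  let ?M = "lebesgue_on D"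
  define P where "P = {x \<in> space ?M. h x > 0}"
  have [measurable]: "h \<in> borel_measurable ?M" using h by auto
  have "P \<in> sets ?M" unfolding P_def by measurable
  then have "P \<in> sets lebesgue" using D by (simp add: sets_restrict_space_iff)
  then obtain C T where CT: "fsigma C" "T \<in> null_sets lebesgue" "C \<union> T = P"
    by (rule lebesgue_set_almost_fsigma)
  from CT(1) obtain F :: "nat \<Rightarrow> 'a set" where "range F \<subseteq> Collect compact \<and> C = \<Union>(range F)"
    unfolding fsigma_Union_compact by (rule exE)
  then have F: "\<And>i. compact (F i)" "C = \<Union>(range F)" by auto
  have FP: "F i \<subseteq> P" for i using F CT by blast
  then have FD: "F i \<subseteq> D" for i by (auto simp: P_def)
  have "AE x in ?M. x \<notin> F i" for i
  proof -
    have F_sets: "F i \<in> sets ?M"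
      using F(1)[of i] FD[of i] D by (simp add: sets_restrict_space_iff compact_imp_closed)
    have "AE x in ?M. indicator (F i) x * h x = 0"
    proof (subst integral_nonneg_eq_0_iff_AE[symmetric])
      show "integrable ?M (\<lambda>x. indicator (F i) x * h x)"
        using integrable_mult_indicator[OF F_sets h] by simp
      show "AE x in ?M. 0 \<le> indicator (F i) x * h x"
        using FP[of i] by (intro AE_I2) (auto simp: P_def indicator_def)
      show "(LINT x|?M. indicator (F i) x * h x) = 0" by (rule zero[OF F(1) FD])
    qed
    then show ?thesis
    proof eventually_elim
      case (elim x)
      then show ?case using FP[of i] by (auto simp: P_def)
    qed
  qed
  then have "AE x in ?M. \<forall>i. x \<notin> F i" by (simp add: AE_all_countable)
  moreover have "AE x in ?M. x \<notin> T"
    using AE_not_in[OF CT(2)] D by (auto simp: AE_restrict_space_iff)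
  moreover have "AE x in ?M. x \<in> space ?M" by (rule AE_space)
  ultimately show ?thesis
  proof eventually_elim
    case (elim x)
    then have "x \<notin> P" using CT(3) F(2) by blast
    then show ?case using elim by (auto simp: P_def)
  qed
qed

lemma AE_zero_if_compact_integrals_zero:
  fixes h :: "'a::euclidean_space \<Rightarrow> complex"
  assumes D: "D \<in> sets lebesgue" and h: "integrable (lebesgue_on D) h"
    and zero: "\<And>A. compact A \<Longrightarrow> A \<subseteq> D \<Longrightarrow> (LINT x|lebesgue_on D. indicator A x * h x) = 0"
  shows "AE x in lebesgue_on D. h x = 0"
proof -
  let ?M = "lebesgue_on D"
  have int: "integrable ?M (\<lambda>x. indicator A x * h x)" if "compact A" "A \<subseteq> D" for A
  proof -
    have "A \<in> sets ?M" using that D by (simp add: sets_restrict_space_iff compact_imp_closed)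
    then have "integrable ?M (\<lambda>x. indicator A x *\<^sub>R h x)" by (rule integrable_mult_indicator[OF _ h])
    also have "(\<lambda>x. indicator A x *\<^sub>R h x) = (\<lambda>x. indicator A x * h x)" by (auto simp: indicator_def)
    finally show ?thesis .
  qed
  have Re0: "(LINT x|?M. indicator A x * Re (h x)) = 0" if "compact A" "A \<subseteq> D" for A
  proof -
    have "(LINT x|?M. Re (indicator A x * h x)) = 0"
      using integral_Re[OF int[OF that]] zero[OF that] by simp
    also have "(\<lambda>x. Re (indicator A x * h x)) = (\<lambda>x. indicator A x * Re (h x))" by (auto simp: indicator_def)
    finally show ?thesis .
  qed
  have Im0: "(LINT x|?M. indicator A x * Im (h x)) = 0" if "compact A" "A \<subseteq> D" for A
  proof -
    have "(LINT x|?M. Im (indicator A x * h x)) = 0"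
      using integral_Im[OF int[OF that]] zero[OF that] by simp
    also have "(\<lambda>x. Im (indicator A x * h x)) = (\<lambda>x. indicator A x * Im (h x))" by (auto simp: indicator_def)
    finally show ?thesis .
  qed
  have "AE x in ?M. Re (h x) \<le> 0" "AE x in ?M. - Re (h x) \<le> 0"
       "AE x in ?M. Im (h x) \<le> 0" "AE x in ?M. - Im (h x) \<le> 0"
    using D h Re0 Im0 by (intro AE_nonpos_if_compact_integrals_zero; simp add: integrable_Re integrable_Im)+
  then show ?thesis by eventually_elim (simp add: complex_eq_iff)
qed

text \<open>Small translates \<open>y + \<delta> e\<^sub>j\<close> of a point \<open>y\<close> of the set. They form a basis unless
  \<open>\<delta> + (\<Sum>j. y\<^sub>j) = 0\<close>, and of the two candidates for \<open>\<delta>\<close> at most one is excluded.\<close>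

lemma open_contains_spanning_vectors:
  fixes S :: "(real ^ 'd) set"
  assumes "open S" "S \<noteq> {}"
  obtains Y where "\<And>j. Y j \<in> S" "\<And>v. (\<And>j::'d. Y j \<bullet> v = 0) \<Longrightarrow> v = 0"
proof -
  obtain y where y: "y \<in> S" using assms by blast
  then obtain e where e: "e > 0" "ball y e \<subseteq> S" using openE[OF assms(1)] by metis
  define s where "s = (\<Sum>j\<in>UNIV. y $ j)"
  obtain \<delta> where \<delta>: "\<delta> > 0" "\<delta> < e" "\<delta> + s \<noteq> 0"
  proof (cases "e/2 + s = 0")
    case True then show ?thesis using that[of "e/4"] e by auto
  next
    case False then show ?thesis using that[of "e/2"] e by auto
  qed
  define Y where "Y = (\<lambda>j::'d. y + \<delta> *\<^sub>R axis j 1)"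
  have "Y j \<in> S" for j using e \<delta> by (auto simp: Y_def dist_norm)
  moreover have "v = 0" if v: "\<And>j. Y j \<bullet> v = 0" for v
  proof -
    have vj: "\<delta> * v $ j = - (y \<bullet> v)" for j
      using v[of j] by (simp add: Y_def inner_add_left inner_axis')
    have "\<delta> * (y \<bullet> v) = (\<Sum>j\<in>UNIV. y $ j * (\<delta> * v $ j))"
      by (simp add: inner_vec_def sum_distrib_left mult_ac)
    also have "\<dots> = - s * (y \<bullet> v)" by (simp only: vj s_def sum_distrib_right[symmetric])
    finally have "(\<delta> + s) * (y \<bullet> v) = 0" by (simp add: algebra_simps)
    then have "y \<bullet> v = 0" using \<delta> by simp
    then show ?thesis using vj \<delta> by (simp add: vec_eq_iff)
  qed
  ultimately show ?thesis using that by blast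
qed

context weighted_cone
begin

definition decay :: "real ^ 'd \<Rightarrow> real ^ 'd \<Rightarrow> complex" where
  "decay y \<xi> = complex_of_real (exp (- (y \<bullet> \<xi>)))"

lemma decay_add: "decay (x + y) \<xi> = decay x \<xi> * decay y \<xi>"
  unfolding decay_def inner_add_left minus_add_distrib exp_add of_real_mult ..

lemma decay_zero [simp]: "decay 0 \<xi> = 1" by (simp add: decay_def)

lemma norm_decay: "cmod (decay y \<xi>) = exp (- (y \<bullet> \<xi>))"
  by (simp add: decay_def)

lemma decay_measurable [measurable]: "decay y \<in> borel_measurable M"
  unfolding decay_def by (intro continuous_imp_measurable_M continuous_intros)

text \<open>Besides the decaying exponentials the constant 1 is tested (\<open>y = 0\<close>), so that the functions tested
  are closed under products and contain the constants.\<close>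

definition annihilates_decay :: "(real ^ 'd \<Rightarrow> complex) \<Rightarrow> bool" where
  "annihilates_decay g \<longleftrightarrow> integrable M g \<and> (\<forall>y\<in>insert 0 \<Omega>. (LINT \<xi>|M. decay y \<xi> * g \<xi>) = 0)"

lemma integrable_bounded_mult:
  assumes "integrable M g" "b \<in> borel_measurable M" "\<And>\<xi>. \<xi> \<in> dual_cone \<Omega> \<Longrightarrow> cmod (b \<xi>) \<le> B"
  shows "integrable M (\<lambda>\<xi>. b \<xi> * g \<xi>)"
proof (rule Bochner_Integration.integrable_bound)
  show "integrable M (\<lambda>\<xi>. B * cmod (g \<xi>))" using assms by simp
  note [measurable] = assms(2) borel_measurable_integrable[OF assms(1)]
  show "(\<lambda>\<xi>. b \<xi> * g \<xi>) \<in> borel_measurable M" by measurable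
  have "cmod (b \<xi> * g \<xi>) \<le> B * cmod (g \<xi>)" if "\<xi> \<in> dual_cone \<Omega>" for \<xi>
    using mult_right_mono[OF assms(3)[OF that], of "cmod (g \<xi>)"] by (simp add: norm_mult)
  then show "AE \<xi> in M. norm (b \<xi> * g \<xi>) \<le> norm (B * cmod (g \<xi>))"
    by (intro AE_I2) force
qed

lemma integrable_decay_mult:
  assumes "integrable M g" "y \<in> insert 0 \<Omega>"
  shows "integrable M (\<lambda>\<xi>. decay y \<xi> * g \<xi>)"
proof (rule integrable_bounded_mult[OF assms(1) decay_measurable])
  fix \<xi> assume "\<xi> \<in> dual_cone \<Omega>"
  then show "cmod (decay y \<xi>) \<le> 1" using assms(2) by (auto simp: norm_decay dual_cone_def)
qed

lemma annihilates_decay_mult: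
  assumes "annihilates_decay g" "y \<in> \<Omega>"
  shows "annihilates_decay (\<lambda>\<xi>. decay y \<xi> * g \<xi>)"
  unfolding annihilates_decay_def
proof (intro conjI ballI)
  show "integrable M (\<lambda>\<xi>. decay y \<xi> * g \<xi>)"
    using assms by (intro integrable_decay_mult) (auto simp: annihilates_decay_def)
  fix x assume "x \<in> insert 0 \<Omega>"
  then have "x + y \<in> insert 0 \<Omega>" using add_\<Omega> assms(2) by auto
  then have "(LINT \<xi>|M. decay (x + y) \<xi> * g \<xi>) = 0"
    using assms(1) by (simp only: annihilates_decay_def)
  then show "(LINT \<xi>|M. decay x \<xi> * (decay y \<xi> * g \<xi>)) = 0" by (simp add: decay_add mult.assoc)
qed

lemma annihilates_decay_add:
  assumes "annihilates_decay g" "annihilates_decay h"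
  shows "annihilates_decay (\<lambda>\<xi>. g \<xi> + h \<xi>)"
  using assms integrable_decay_mult unfolding annihilates_decay_def
  by (auto simp: distrib_left)

lemma annihilates_decay_scale:
  assumes "annihilates_decay g"
  shows "annihilates_decay (\<lambda>\<xi>. c * g \<xi>)"
  using assms unfolding annihilates_decay_def by (auto simp: mult.left_commute[of _ c])

lemma annihilates_decay_sum:
  assumes "finite I" "\<And>i. i \<in> I \<Longrightarrow> annihilates_decay (g i)"
  shows "annihilates_decay (\<lambda>\<xi>. \<Sum>i\<in>I. g i \<xi>)"
  using assms
proof (induction I)
  case empty then show ?case by (simp add: annihilates_decay_def)
next
  case (insert i I) then show ?case by (simp add: annihilates_decay_add)
qed

text \<open>Products of the coordinates \<open>exp (- \<langle>Y j, \<xi>\<rangle>)\<close> are again exponentials with exponent in the cone,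
  because the cone is closed under addition; so every polynomial in them is annihilated as well.\<close>

lemma annihilates_decay_polynomial:
  fixes Y :: "'d \<Rightarrow> real ^ 'd"
  assumes "real_polynomial_function P" "annihilates_decay g" and Y: "\<And>j. Y j \<in> \<Omega>"
  shows "annihilates_decay (\<lambda>\<xi>. complex_of_real (P (\<chi> j. exp (- (Y j \<bullet> \<xi>)))) * g \<xi>)"
  using assms(1,2)
proof (induction arbitrary: g rule: real_polynomial_function.induct)
  case (linear P)
  have expand: "P (\<chi> j. exp (- (Y j \<bullet> \<xi>))) = (\<Sum>j\<in>UNIV. exp (- (Y j \<bullet> \<xi>)) * P (axis j 1))" for \<xi>
  proof -
    have "P v = (\<Sum>j\<in>UNIV. v $ j * P (axis j 1))" for v
    proof -
      have "P v = P (\<Sum>j\<in>UNIV. (v $ j) *\<^sub>R axis j 1)"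
        unfolding scalar_mult_eq_scaleR[symmetric] basis_expansion ..
      also have "\<dots> = (\<Sum>j\<in>UNIV. v $ j * P (axis j 1))"
        using linear(1) by (simp add: bounded_linear.linear linear_sum linear_scale)
      finally show ?thesis .
    qed
    from this[of "\<chi> j. exp (- (Y j \<bullet> \<xi>))"] show ?thesis by simp
  qed
  have "(\<lambda>\<xi>. complex_of_real (P (\<chi> j. exp (- (Y j \<bullet> \<xi>)))) * g \<xi>)
     = (\<lambda>\<xi>. \<Sum>j\<in>UNIV. complex_of_real (P (axis j 1)) * (decay (Y j) \<xi> * g \<xi>))"
    unfolding expand decay_def of_real_sum of_real_mult sum_distrib_right
    by (intro ext sum.cong refl) (simp only: mult_ac)
  then show ?case
    by (simp only:)
       (intro annihilates_decay_sum annihilates_decay_scale annihilates_decay_mult linear(2) Y finite)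
next
  case (const c)
  then show ?case by (simp add: annihilates_decay_scale)
next
  case (add P Q)
  then show ?case by (simp add: distrib_right annihilates_decay_add)
next
  case (mult P Q)
  then show ?case using mult.IH(1)[OF mult.IH(2)] by (simp add: mult.assoc)
qed

text \<open>The coordinates \<open>exp (- \<langle>Y j, \<xi>\<rangle>)\<close> embed the dual cone into a cube, on which polynomials are
  dense; continuous functions of the coordinates approximate the indicator of any compact set.\<close>

lemma annihilates_decay_imp_AE_zero:
  assumes h: "annihilates_decay h"
  shows "AE \<xi> in M. h \<xi> = 0"
proof -
  have int_h: "integrable M h" using h by (simp add: annihilates_decay_def)
  obtain Y :: "'d \<Rightarrow> real ^ 'd" where Y: "\<And>j. Y j \<in> \<Omega>" "\<And>v. (\<And>j. Y j \<bullet> v = 0) \<Longrightarrow> v = 0"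
    using open_contains_spanning_vectors[OF open_\<Omega> nonempty_\<Omega>] by metis
  define \<phi> :: "real ^ 'd \<Rightarrow> real ^ 'd" where "\<phi> = (\<lambda>\<xi>. \<chi> j. exp (- (Y j \<bullet> \<xi>)))"
  define K :: "(real ^ 'd) set" where "K = cbox 0 (\<chi> j. 1)"
  have \<phi>_K: "\<phi> \<xi> \<in> K" if "\<xi> \<in> dual_cone \<Omega>" for \<xi>
    using that Y(1) by (auto simp: K_def \<phi>_def mem_box_cart dual_cone_def)
  have \<phi>_inj: "\<xi> = \<eta>" if "\<phi> \<xi> = \<phi> \<eta>" for \<xi> \<eta>
    using that Y(2)[of "\<xi> - \<eta>"] by (simp add: \<phi>_def vec_eq_iff inner_diff_right)
  have \<phi>_cont: "continuous_on S \<phi>" for S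
    unfolding \<phi>_def by (intro continuous_intros)
  have cont_zero: "(LINT \<xi>|M. complex_of_real (H (\<phi> \<xi>)) * h \<xi>) = 0"
    and cont_int: "integrable M (\<lambda>\<xi>. complex_of_real (H (\<phi> \<xi>)) * h \<xi>)"
    if H: "continuous_on K H" for H :: "real ^ 'd \<Rightarrow> real"
  proof -
    have comp: "integrable M (\<lambda>\<xi>. complex_of_real (G (\<phi> \<xi>)) * h \<xi>)" if G: "continuous_on K G" for G
    proof -
      have "bounded (G ` K)" using G by (intro compact_imp_bounded compact_continuous_image) (auto simp: K_def)
      then obtain B where B: "\<And>x. x \<in> K \<Longrightarrow> \<bar>G x\<bar> \<le> B" unfolding bounded_iff by auto
      have "continuous_on (dual_cone \<Omega>) (\<lambda>\<xi>. G (\<phi> \<xi>))"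
        using continuous_on_compose2[OF G \<phi>_cont] \<phi>_K by blast
      then show ?thesis
        by (intro integrable_bounded_mult[OF int_h, where B = B] continuous_imp_measurable_M continuous_intros)
           (use B \<phi>_K in auto)
    qed
    show "integrable M (\<lambda>\<xi>. complex_of_real (H (\<phi> \<xi>)) * h \<xi>)" by (rule comp[OF H])
    let ?I = "LINT \<xi>|M. cmod (h \<xi>)"
    have "cmod (LINT \<xi>|M. complex_of_real (H (\<phi> \<xi>)) * h \<xi>) \<le> 0 + e" if "e > 0" for e
    proof -
      define e' where "e' = e / (?I + 1)"
      have I: "?I \<ge> 0" by simp
      then have e': "e' > 0" unfolding e'_def using \<open>e > 0\<close> by (intro divide_pos_pos) linarith+
      obtain P where P: "polynomial_function P" "\<And>x. x \<in> K \<Longrightarrow> norm (H x - P x) < e'"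
        using Stone_Weierstrass_polynomial_function[OF _ H e'] by (auto simp: K_def)
      have "real_polynomial_function P" using P(1) by (simp add: real_polynomial_function_eq)
      then have "annihilates_decay (\<lambda>\<xi>. complex_of_real (P (\<phi> \<xi>)) * h \<xi>)"
        unfolding \<phi>_def by (rule annihilates_decay_polynomial[OF _ h Y(1)])
      then have P0: "(LINT \<xi>|M. complex_of_real (P (\<phi> \<xi>)) * h \<xi>) = 0"
        by (simp add: annihilates_decay_def)
      have P_int: "integrable M (\<lambda>\<xi>. complex_of_real (P (\<phi> \<xi>)) * h \<xi>)"
        by (intro comp continuous_on_polymonial_function P)
      have "(LINT \<xi>|M. complex_of_real (H (\<phi> \<xi>)) * h \<xi>)
          = (LINT \<xi>|M. complex_of_real (H (\<phi> \<xi>)) * h \<xi> - complex_of_real (P (\<phi> \<xi>)) * h \<xi>)"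
        using P0 comp[OF H] P_int by simp
      also have "cmod \<dots> \<le> (LINT \<xi>|M. e' * cmod (h \<xi>))"
      proof (rule Bochner_Integration.integral_norm_bound_integral)
        show "integrable M (\<lambda>\<xi>. complex_of_real (H (\<phi> \<xi>)) * h \<xi> - complex_of_real (P (\<phi> \<xi>)) * h \<xi>)"
          using comp[OF H] P_int by simp
        show "integrable M (\<lambda>\<xi>. e' * cmod (h \<xi>))" using int_h by simp
        fix \<xi> assume "\<xi> \<in> space M"
        then have "\<bar>H (\<phi> \<xi>) - P (\<phi> \<xi>)\<bar> \<le> e'" using P(2)[OF \<phi>_K] by fastforce
        then have "\<bar>H (\<phi> \<xi>) - P (\<phi> \<xi>)\<bar> * cmod (h \<xi>) \<le> e' * cmod (h \<xi>)" by (intro mult_right_mono) auto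
        then show "cmod (complex_of_real (H (\<phi> \<xi>)) * h \<xi> - complex_of_real (P (\<phi> \<xi>)) * h \<xi>) \<le> e' * cmod (h \<xi>)"
          by (simp add: left_diff_distrib[symmetric] norm_mult flip: of_real_diff)
      qed
      also have "\<dots> = e' * ?I" by simp
      also have "\<dots> \<le> e' * (?I + 1)" using e' by simp
      also have "\<dots> = 0 + e" using I unfolding e'_def by (smt (verit) nonzero_eq_divide_eq)
      finally show ?thesis .
    qed
    then have "cmod (LINT \<xi>|M. complex_of_real (H (\<phi> \<xi>)) * h \<xi>) \<le> 0" by (rule field_le_epsilon)
    then show "(LINT \<xi>|M. complex_of_real (H (\<phi> \<xi>)) * h \<xi>) = 0" by simp
  qed
  show ?thesis
  proof (rule AE_zero_if_compact_integrals_zero[OF sets_dual_cone int_h])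
    fix A assume A: "compact A" "A \<subseteq> dual_cone \<Omega>"
    show "(LINT \<xi>|M. indicator A \<xi> * h \<xi>) = 0"
    proof (cases "A = {}")
      case False
      define C where "C = \<phi> ` A"
      have C: "closed C" "C \<noteq> {}"
        using A False \<phi>_cont by (auto simp: C_def intro!: compact_imp_closed compact_continuous_image)
      \<comment> \<open>continuous functions decreasing to the indicator function of \<open>C\<close>\<close>
      define H where "H = (\<lambda>(m::nat) x. max 0 (1 - real m * infdist x C))"
      have H_cont: "continuous_on S (H m)" for S m
        unfolding H_def by (intro continuous_intros)
      have "(\<lambda>m. LINT \<xi>|M. complex_of_real (H m (\<phi> \<xi>)) * h \<xi>) \<longlonglongrightarrow> (LINT \<xi>|M. indicator A \<xi> * h \<xi>)"
      proof (rule integral_dominated_convergence)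
        have "A \<in> sets M" using A by (simp add: sets_restrict_space_iff compact_imp_closed)
        note [measurable] = this borel_measurable_integrable[OF int_h]
        show "(\<lambda>\<xi>. indicator A \<xi> * h \<xi>) \<in> borel_measurable M" by measurable
        show "integrable M (\<lambda>\<xi>. cmod (h \<xi>))" using int_h by simp
        show "(\<lambda>\<xi>. complex_of_real (H m (\<phi> \<xi>)) * h \<xi>) \<in> borel_measurable M" for m
          using cont_int[OF H_cont] by (rule borel_measurable_integrable)
        show "AE \<xi> in M. (\<lambda>m. complex_of_real (H m (\<phi> \<xi>)) * h \<xi>) \<longlonglongrightarrow> indicator A \<xi> * h \<xi>"
        proof (rule AE_I2)
          fix \<xi>
          show "(\<lambda>m. complex_of_real (H m (\<phi> \<xi>)) * h \<xi>) \<longlonglongrightarrow> indicator A \<xi> * h \<xi>"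
          proof (cases "\<xi> \<in> A")
            case True
            then have "H m (\<phi> \<xi>) = 1" for m by (simp add: H_def C_def)
            then show ?thesis using True by simp
          next
            case False
            then have "\<phi> \<xi> \<notin> C" using \<phi>_inj by (auto simp: C_def)
            then have pos: "infdist (\<phi> \<xi>) C > 0" using C by (simp add: infdist_pos_not_in_closed)
            obtain m0 :: nat where m0: "1 / infdist (\<phi> \<xi>) C \<le> real m0" using real_arch_simple by blast
            have "H m (\<phi> \<xi>) = 0" if "m \<ge> m0" for m
            proof -
              have "1 / infdist (\<phi> \<xi>) C \<le> real m" using m0 that by linarith
              then show ?thesis using pos by (simp add: H_def field_simps)
            qed
            then have "eventually (\<lambda>m. complex_of_real (H m (\<phi> \<xi>)) * h \<xi> = indicator A \<xi> * h \<xi>) sequentially"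
              using False by (auto simp: eventually_sequentially)
            then show ?thesis by (rule tendsto_eventually)
          qed
        qed
        show "AE \<xi> in M. norm (complex_of_real (H m (\<phi> \<xi>)) * h \<xi>) \<le> cmod (h \<xi>)" for m
          by (intro AE_I2) (auto simp: norm_mult H_def infdist_nonneg intro!: mult_left_le_one_le)
      qed
      then have "(\<lambda>m::nat. 0) \<longlonglongrightarrow> (LINT \<xi>|M. indicator A \<xi> * h \<xi>)"
        using cont_zero[OF H_cont] by simp
      then show ?thesis by (simp add: LIMSEQ_const_iff)
    qed simp
  qed
qed

text \<open>At the points \<open>i y\<close> of the tube the transform is a real Laplace transform. A factor
  \<open>exp (- \<langle>y0, \<xi>\<rangle>)\<close> is split off to make \<open>f\<close> integrable.\<close>

theorem Laplace_zero_imp_AE_zero: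
  assumes f: "f \<in> L2" and zero: "\<And>z. z \<in> tube \<Omega> \<Longrightarrow> Laplace \<Omega> f z = 0"
  shows "AE \<xi> in M. f \<xi> = 0"
proof -
  obtain y0 where y0: "y0 \<in> \<Omega>" using nonempty_\<Omega> by blast
  define iy :: "real ^ 'd \<Rightarrow> complex ^ 'd" where "iy = (\<lambda>y. \<chi> j. \<i> * complex_of_real (y $ j))"
  have iy_tube: "iy y \<in> tube \<Omega>" if "y \<in> \<Omega>" for y
    using that by (simp add: tube_def iy_def)
  have iy_exp: "exp (\<i> * pairing (iy y) \<xi>) = decay y \<xi>" for y \<xi>
  proof -
    have "\<i> * pairing (iy y) \<xi> = complex_of_real (- (y \<bullet> \<xi>))"
      by (simp add: pairing_def iy_def inner_vec_def sum_distrib_left mult.assoc[symmetric] sum_negf[symmetric])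
    then show ?thesis by (simp only: decay_def exp_of_real)
  qed
  have "annihilates_decay (\<lambda>\<xi>. decay y0 \<xi> * f \<xi>)"
    unfolding annihilates_decay_def
  proof (intro conjI ballI)
    show "integrable M (\<lambda>\<xi>. decay y0 \<xi> * f \<xi>)"
      using Laplace_integrable[OF f iy_tube[OF y0]] by (simp only: iy_exp)
    fix y assume "y \<in> insert 0 \<Omega>"
    then have "y + y0 \<in> \<Omega>" using add_\<Omega> y0 by auto
    then have "Laplace \<Omega> f (iy (y + y0)) = 0" by (intro zero iy_tube)
    then show "(LINT \<xi>|M. decay y \<xi> * (decay y0 \<xi> * f \<xi>)) = 0"
      by (simp only: Laplace_def iy_exp decay_add mult.assoc)
  qed
  then have "AE \<xi> in M. decay y0 \<xi> * f \<xi> = 0" by (rule annihilates_decay_imp_AE_zero)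
  then show ?thesis by eventually_elim (simp add: decay_def)
qed

end

section \<open>Completeness\<close>

lemma geometric_increments_converge:
  fixes a :: "nat \<Rightarrow> 'a::banach"
  assumes "\<And>k. norm (a (Suc k) - a k) \<le> B * r ^ k" and r: "0 \<le> r" "r < 1"
  shows "convergent a" "norm (lim a - a m) \<le> B * r ^ m / (1 - r)"
proof -
  have geo: "summable (\<lambda>k. B * r ^ m * r ^ k)" for m
    using r by (intro summable_mult summable_geometric) simp
  have incr: "norm (a (Suc k + m) - a (k + m)) \<le> B * r ^ m * r ^ k" for k m
    using assms(1)[of "k + m"] by (simp add: power_add mult_ac)
  have summ: "summable (\<lambda>k. norm (a (Suc k + m) - a (k + m)))" for m
    by (rule summable_comparison_test[OF _ geo]) (use incr in auto)
  have "(\<lambda>k. \<Sum>j<k. a (Suc j) - a j) \<longlonglongrightarrow> (\<Sum>k. a (Suc k) - a k)"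
    using summable_norm_cancel[OF summ[of 0]] by (intro summable_LIMSEQ) simp
  then have "(\<lambda>k. a k - a 0) \<longlonglongrightarrow> (\<Sum>k. a (Suc k) - a k)"
    by (simp add: sum_lessThan_telescope)
  from tendsto_add[OF this tendsto_const[of "a 0"]] show conv: "convergent a"
    by (auto simp: convergent_def)
  have "(\<lambda>k. a (k + m)) \<longlonglongrightarrow> lim a"
    using conv by (intro LIMSEQ_ignore_initial_segment) (simp add: convergent_LIMSEQ_iff)
  from telescope_sums[OF this] have "lim a - a m = (\<Sum>k. a (Suc k + m) - a (k + m))"
    by (simp add: sums_iff)
  also have "norm \<dots> \<le> (\<Sum>k. norm (a (Suc k + m) - a (k + m)))"
    by (rule summable_norm[OF summ])
  also have "\<dots> \<le> (\<Sum>k. B * r ^ m * r ^ k)"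
    by (intro suminf_le incr summ geo)
  also have "\<dots> = B * r ^ m / (1 - r)"
    using r by (simp add: suminf_mult suminf_geometric)
  finally show "norm (lim a - a m) \<le> B * r ^ m / (1 - r)" .
qed

lemma three_quarters_power_sq: "((3/4 :: real) ^ k)\<^sup>2 = (9/16) ^ k"
proof -
  have "((3/4 :: real) ^ k)\<^sup>2 = ((3/4)\<^sup>2) ^ k" by (simp only: power_mult[symmetric] mult.commute[of k])
  then show ?thesis by (simp add: power2_eq_square)
qed

context weighted_cone
begin

text \<open>Riesz--Fischer for sequences with geometrically small increments \<open>d\<^sub>k\<close>. The function
  \<open>G = (\<Sum>k. (16/9)\<^sup>k |d\<^sub>k|\<^sup>2 w)\<close> is integrable, and wherever it is finite it dominates every single
  term, so the increments decay like \<open>(3/4)\<^sup>k\<close> there and the squared distance to the limit is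
  bounded by a small multiple of \<open>G\<close>.\<close>

lemma L2_complete:
  assumes f: "\<And>k. f k \<in> L2"
    and incr: "\<And>k. (LINT \<xi>|M. (cmod (f (Suc k) \<xi> - f k \<xi>))\<^sup>2 * wt \<xi>) \<le> (C * (1/2) ^ k)\<^sup>2"
  obtains g where "g \<in> L2" "(\<lambda>k. LINT \<xi>|M. (cmod (f k \<xi> - g \<xi>))\<^sup>2 * wt \<xi>) \<longlonglongrightarrow> 0"
proof -
  note [measurable] = L2_measurable[OF f]
  define d where "d = (\<lambda>k \<xi>. (cmod (f (Suc k) \<xi> - f k \<xi>))\<^sup>2 * wt \<xi>)"
  have [measurable]: "d k \<in> borel_measurable M" for k unfolding d_def by measurable
  have d_nonneg: "d k \<xi> \<ge> 0" for k \<xi> by (simp add: d_def weight_nonneg)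
  have d_int: "integrable M (d k)" for k
    unfolding d_def using L2_integrable[OF L2_diff[OF f f]] .
  define G where "G = (\<lambda>\<xi>. \<Sum>k. ennreal ((16/9) ^ k * d k \<xi>))"
  have G_meas [measurable]: "G \<in> borel_measurable M" unfolding G_def by measurable
  have "(\<integral>\<^sup>+ \<xi>. G \<xi> \<partial>M) = (\<Sum>k. \<integral>\<^sup>+ \<xi>. ennreal ((16/9) ^ k * d k \<xi>) \<partial>M)"
    unfolding G_def by (rule nn_integral_suminf) measurable
  also have "\<dots> = (\<Sum>k. ennreal ((16/9) ^ k * (LINT \<xi>|M. d k \<xi>)))"
    using d_int d_nonneg by (intro suminf_cong) (subst nn_integral_eq_integral; simp)
  also have "\<dots> \<le> (\<Sum>k. ennreal (C\<^sup>2 * (4/9) ^ k))"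
  proof (intro suminf_le ennreal_leI summableI)
    fix k :: nat
    have "(16/9) ^ k * (LINT \<xi>|M. d k \<xi>) \<le> (16/9) ^ k * (C * (1/2) ^ k)\<^sup>2"
      using incr[of k] by (intro mult_left_mono) (auto simp: d_def)
    also have "\<dots> = C\<^sup>2 * (4/9) ^ k"
    proof -
      have "(16/9 :: real) ^ k * ((1/2) ^ k)\<^sup>2 = (16/9 * (1/2)\<^sup>2) ^ k"
        by (simp only: power_mult_distrib power_mult[symmetric] mult.commute[of k])
      also have "\<dots> = (4/9) ^ k" by (simp add: power2_eq_square)
      finally show ?thesis by (simp add: power_mult_distrib mult.left_commute)
    qed
    finally show "(16/9) ^ k * (LINT \<xi>|M. d k \<xi>) \<le> C\<^sup>2 * (4/9) ^ k" .
  qed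
  also have "\<dots> = ennreal (\<Sum>k. C\<^sup>2 * (4/9) ^ k)"
    by (intro suminf_ennreal2 summable_mult summable_geometric) auto
  also have "\<dots> < \<infinity>" by simp
  finally have G_fin: "(\<integral>\<^sup>+ \<xi>. G \<xi> \<partial>M) < \<infinity>" .
  then obtain S where S: "(\<integral>\<^sup>+ \<xi>. G \<xi> \<partial>M) = ennreal S" "S \<ge> 0"
    by (metis ennreal_cases infinity_ennreal_def order_less_irrefl)
  define g where "g = (\<lambda>\<xi>. lim (\<lambda>k. f k \<xi>))"
  have [measurable]: "g \<in> borel_measurable M" unfolding g_def by measurable
  have "AE \<xi> in M. G \<xi> \<noteq> \<infinity>"
    using G_fin by (intro nn_integral_PInf_AE) auto
  then have close: "AE \<xi> in M. ennreal ((cmod (f m \<xi> - g \<xi>))\<^sup>2 * wt \<xi>) \<le> ennreal (16 * (9/16) ^ m) * G \<xi>" for m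
  proof eventually_elim
    case (elim \<xi>)
    then obtain b where b: "G \<xi> = ennreal b" "b \<ge> 0" by (metis ennreal_cases infinity_ennreal_def)
    define B where "B = sqrt (b / wt \<xi>)"
    have w: "wt \<xi> > 0" using weight_ge_1[of \<xi>] by linarith
    have B: "B\<^sup>2 = b / wt \<xi>" "B \<ge> 0" using b w by (simp_all add: B_def)
    have "cmod (f (Suc k) \<xi> - f k \<xi>) \<le> B * (3/4) ^ k" for k
    proof -
      define t where "t = (\<lambda>k. ennreal ((16/9) ^ k * d k \<xi>))"
      have "t k \<le> suminf t" using sum_le_suminf[of t "{k}"] by simp
      then have "(16/9) ^ k * d k \<xi> \<le> b" using b by (simp add: G_def t_def)
      then have "(9/16) ^ k * ((16/9) ^ k * d k \<xi>) \<le> (9/16) ^ k * b" by (intro mult_left_mono) auto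
      moreover have "(9/16 :: real) ^ k * (16/9) ^ k = 1" by (simp flip: power_mult_distrib)
      ultimately have "d k \<xi> \<le> (9/16) ^ k * b" by (simp add: mult.assoc[symmetric])
      then have "(cmod (f (Suc k) \<xi> - f k \<xi>))\<^sup>2 \<le> b / wt \<xi> * (9/16) ^ k"
        using w by (simp add: d_def field_simps)
      also have "\<dots> = (B * (3/4) ^ k)\<^sup>2"
        by (simp only: power_mult_distrib three_quarters_power_sq B)
      finally show ?thesis by (rule power2_le_imp_le) (use B in simp)
    qed
    from geometric_increments_converge(2)[where a = "\<lambda>k. f k \<xi>", OF this, of m]
    have "cmod (f m \<xi> - g \<xi>) \<le> 4 * B * (3/4) ^ m"
      by (simp add: g_def norm_minus_commute)
    then have "(cmod (f m \<xi> - g \<xi>))\<^sup>2 \<le> (4 * B * (3/4) ^ m)\<^sup>2" by (intro power_mono) auto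
    also have "\<dots> = 16 * (9/16) ^ m * (b / wt \<xi>)"
      by (simp only: power_mult_distrib three_quarters_power_sq B) simp
    finally have "(cmod (f m \<xi> - g \<xi>))\<^sup>2 * wt \<xi> \<le> 16 * (9/16) ^ m * b"
      using w by (simp add: field_simps)
    then show ?case using b by (simp add: ennreal_mult[symmetric])
  qed
  have bound: "(\<integral>\<^sup>+ \<xi>. ennreal ((cmod (f m \<xi> - g \<xi>))\<^sup>2 * wt \<xi>) \<partial>M) \<le> ennreal (16 * (9/16) ^ m * S)" for m
  proof -
    have "(\<integral>\<^sup>+ \<xi>. ennreal ((cmod (f m \<xi> - g \<xi>))\<^sup>2 * wt \<xi>) \<partial>M) \<le> (\<integral>\<^sup>+ \<xi>. ennreal (16 * (9/16) ^ m) * G \<xi> \<partial>M)"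
      by (rule nn_integral_mono_AE[OF close])
    also have "\<dots> = ennreal (16 * (9/16) ^ m) * ennreal S" by (simp add: nn_integral_cmult S)
    also have "\<dots> = ennreal (16 * (9/16) ^ m * S)" using S(2) by (simp add: ennreal_mult)
    finally show ?thesis .
  qed
  have int: "integrable M (\<lambda>\<xi>. (cmod (f m \<xi> - g \<xi>))\<^sup>2 * wt \<xi>)" for m
  proof (rule integrableI_bounded)
    show "(\<integral>\<^sup>+ \<xi>. ennreal (norm ((cmod (f m \<xi> - g \<xi>))\<^sup>2 * wt \<xi>)) \<partial>M) < \<infinity>"
      using le_less_trans[OF bound[of m]] by (simp add: weight_nonneg)
  qed measurable
  have "(\<lambda>\<xi>. f 0 \<xi> - g \<xi>) \<in> L2" using int[of 0] by (simp add: L2w_def)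
  from L2_diff[OF f[of 0] this] have "g \<in> L2" by simp
  moreover have "(\<lambda>k. LINT \<xi>|M. (cmod (f k \<xi> - g \<xi>))\<^sup>2 * wt \<xi>) \<longlonglongrightarrow> 0"
  proof (rule tendsto_sandwich[OF _ _ tendsto_const])
    show "\<forall>\<^sub>F k in sequentially. 0 \<le> (LINT \<xi>|M. (cmod (f k \<xi> - g \<xi>))\<^sup>2 * wt \<xi>)"
      by (intro always_eventually allI integral_nonneg_AE AE_I2) (simp add: weight_nonneg)
    have "(LINT \<xi>|M. (cmod (f k \<xi> - g \<xi>))\<^sup>2 * wt \<xi>) \<le> 16 * (9/16) ^ k * S" for k
      using bound[of k] S(2) nn_integral_eq_integral[OF int[of k]] by (simp add: weight_nonneg)
    then show "\<forall>\<^sub>F k in sequentially. (LINT \<xi>|M. (cmod (f k \<xi> - g \<xi>))\<^sup>2 * wt \<xi>) \<le> 16 * (9/16) ^ k * S"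
      by simp
    have "(\<lambda>k. 16 * (9/16 :: real) ^ k * S) \<longlonglongrightarrow> 16 * 0 * S"
      by (intro tendsto_intros LIMSEQ_power_zero) auto
    then show "(\<lambda>k. 16 * (9/16 :: real) ^ k * S) \<longlonglongrightarrow> 0" by simp
  qed
  ultimately show ?thesis using that by blast
qed

section \<open>The Hardy--Sobolev space as a reproducing kernel space\<close>

text \<open>The extension by zero makes this a bijection from classes of densities onto the Hardy--Sobolev
  space.\<close>

definition transform :: "(real ^ 'd \<Rightarrow> complex) \<Rightarrow> complex ^ 'd \<Rightarrow> complex" where
  "transform f z = (if z \<in> tube \<Omega> then Laplace \<Omega> f z else 0)"

lemma transform_mem:
  assumes "f \<in> L2" shows "transform f \<in> HS \<Omega> \<rho> n"
proof -
  have "holomorphic_sev (transform f) (tube \<Omega>)"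
    unfolding holomorphic_sev_def
  proof
    fix z assume z: "z \<in> tube \<Omega>"
    then obtain a where "(Laplace \<Omega> f has_derivative (\<lambda>h. \<Sum>j\<in>UNIV. a $ j * h $ j)) (at z within tube \<Omega>)"
      using holomorphic_Laplace[OF assms] unfolding holomorphic_sev_def by blast
    then have "(transform f has_derivative (\<lambda>h. \<Sum>j\<in>UNIV. a $ j * h $ j)) (at z within tube \<Omega>)"
      by (rule has_derivative_transform[OF z, rotated]) (simp add: transform_def)
    then show "\<exists>a. (transform f has_derivative (\<lambda>h. \<Sum>j\<in>UNIV. a $ j * h $ j)) (at z within tube \<Omega>)" by blast
  qed
  then show ?thesis using assms by (auto simp: HS_def transform_def)
qed

lemma HS_cases:
  assumes "F \<in> HS \<Omega> \<rho> n"
  obtains f where "f \<in> L2" "F = transform f"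
proof -
  obtain f where "f \<in> L2" "\<forall>z\<in>tube \<Omega>. F z = Laplace \<Omega> f z" "\<forall>z. z \<notin> tube \<Omega> \<longrightarrow> F z = 0"
    using assms by (auto simp: HS_def)
  then show ?thesis by (intro that[of f]) (auto simp: transform_def)
qed

lemma transform_zero: "transform (\<lambda>\<xi>. 0) = (\<lambda>z. 0)"
  by (simp add: transform_def Laplace_def fun_eq_iff)

lemma transform_add: "f \<in> L2 \<Longrightarrow> g \<in> L2 \<Longrightarrow> transform (\<lambda>\<xi>. f \<xi> + g \<xi>) = (\<lambda>z. transform f z + transform g z)"
  by (simp add: transform_def Laplace_add fun_eq_iff)

lemma transform_diff: "f \<in> L2 \<Longrightarrow> g \<in> L2 \<Longrightarrow> transform (\<lambda>\<xi>. f \<xi> - g \<xi>) = (\<lambda>z. transform f z - transform g z)"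
  by (simp add: transform_def Laplace_diff fun_eq_iff)

lemma transform_scale: "transform (\<lambda>\<xi>. c * f \<xi>) = (\<lambda>z. c * transform f z)"
  by (simp add: transform_def Laplace_scale fun_eq_iff)

lemma HS_density_transform:
  assumes "f \<in> L2"
  shows "HS_density \<Omega> \<rho> n (transform f) \<in> L2"
    and "AE \<xi> in M. HS_density \<Omega> \<rho> n (transform f) \<xi> = f \<xi>"
proof -
  let ?d = "HS_density \<Omega> \<rho> n (transform f)"
  have "?d \<in> L2 \<and> (\<forall>z\<in>tube \<Omega>. transform f z = Laplace \<Omega> ?d z)"
    unfolding HS_density_def
    by (rule someI[where x = f]) (use assms in \<open>simp add: transform_def\<close>)
  then show d: "?d \<in> L2" and "AE \<xi> in M. ?d \<xi> = f \<xi>"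
    using Laplace_zero_imp_AE_zero[OF L2_diff[of ?d f]] assms
    by (simp_all add: Laplace_diff transform_def)
qed

lemma HS_inner_transform:
  assumes "f \<in> L2" "g \<in> L2"
  shows "HS_inner \<Omega> \<rho> n (transform f) (transform g) = (LINT \<xi>|M. f \<xi> * cnj (g \<xi>) * complex_of_real (wt \<xi>))"
  unfolding HS_inner_def
proof (rule integral_cong_AE)
  show "(\<lambda>\<xi>. HS_density \<Omega> \<rho> n (transform f) \<xi> * cnj (HS_density \<Omega> \<rho> n (transform g) \<xi>) * complex_of_real (wt \<xi>))
      \<in> borel_measurable M"
    by (intro borel_measurable_integrable L2_product_integrable HS_density_transform assms)
  show "(\<lambda>\<xi>. f \<xi> * cnj (g \<xi>) * complex_of_real (wt \<xi>)) \<in> borel_measurable M"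
    by (intro borel_measurable_integrable L2_product_integrable assms)
  show "AE \<xi> in M. HS_density \<Omega> \<rho> n (transform f) \<xi> * cnj (HS_density \<Omega> \<rho> n (transform g) \<xi>) * complex_of_real (wt \<xi>)
      = f \<xi> * cnj (g \<xi>) * complex_of_real (wt \<xi>)"
    using HS_density_transform(2)[OF assms(1)] HS_density_transform(2)[OF assms(2)]
    by eventually_elim simp
qed

lemma HS_inner_self_transform:
  assumes "f \<in> L2"
  shows "Re (HS_inner \<Omega> \<rho> n (transform f) (transform f)) = (LINT \<xi>|M. (cmod (f \<xi>))\<^sup>2 * wt \<xi>)"
proof -
  have "f \<xi> * cnj (f \<xi>) * complex_of_real (wt \<xi>) = complex_of_real ((cmod (f \<xi>))\<^sup>2 * wt \<xi>)" for \<xi>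
    unfolding of_real_mult complex_norm_square ..
  then show ?thesis by (simp add: HS_inner_transform[OF assms assms] del: of_real_mult)
qed

text \<open>Division by the weight compensates for the weight in the inner product.\<close>

definition kernel_density :: "complex ^ 'd \<Rightarrow> real ^ 'd \<Rightarrow> complex" where
  "kernel_density w \<xi> = cnj (exp (\<i> * pairing w \<xi>)) / complex_of_real (wt \<xi>)"

lemma kernel_density_mem:
  assumes "w \<in> tube \<Omega>" shows "kernel_density w \<in> L2"
proof -
  have [measurable]: "cnj \<in> borel_measurable borel"
    by (intro borel_measurable_continuous_onI continuous_intros)
  have meas [measurable]: "kernel_density w \<in> borel_measurable M"
    unfolding kernel_density_def by measurable
  obtain c where c: "c > 0"
    "\<And>\<xi>. \<xi> \<in> dual_cone \<Omega> \<Longrightarrow> cmod (exp (\<i> * pairing w \<xi>)) \<le> exp (- c * norm \<xi>)"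
    using tube_decay[OF assms] by metis
  have "integrable M (\<lambda>\<xi>. (cmod (kernel_density w \<xi>))\<^sup>2 * wt \<xi>)"
  proof (rule Bochner_Integration.integrable_bound)
    show "integrable M (\<lambda>\<xi>. exp (- (2 * c) * norm \<xi>))"
      using c by (intro integrable_exp_minus_norm_M) simp
    have "(cmod (kernel_density w \<xi>))\<^sup>2 * wt \<xi> \<le> exp (- (2 * c) * norm \<xi>)" if "\<xi> \<in> dual_cone \<Omega>" for \<xi>
    proof -
      have w: "wt \<xi> \<ge> 1" by (rule weight_ge_1)
      have "(cmod (kernel_density w \<xi>))\<^sup>2 * wt \<xi> = (cmod (exp (\<i> * pairing w \<xi>)))\<^sup>2 / wt \<xi>"
        using w by (simp add: kernel_density_def norm_divide power_divide power2_eq_square)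
      also have "\<dots> \<le> (cmod (exp (\<i> * pairing w \<xi>)))\<^sup>2"
        using w by (simp add: divide_le_eq mult_le_cancel_left1)
      also have "\<dots> \<le> (exp (- c * norm \<xi>))\<^sup>2"
        by (intro power_mono c that) auto
      also have "\<dots> = exp (- (2 * c) * norm \<xi>)" by (simp add: exp_double[symmetric])
      finally show ?thesis .
    qed
    then show "AE \<xi> in M. norm ((cmod (kernel_density w \<xi>))\<^sup>2 * wt \<xi>) \<le> norm (exp (- (2 * c) * norm \<xi>))"
      by (intro AE_I2) (simp add: weight_nonneg)
  qed measurable
  then show ?thesis using meas by (simp add: L2w_def)
qed

lemma transform_eq_inner_kernel:
  assumes "f \<in> L2" "w \<in> tube \<Omega>"
  shows "transform f w = HS_inner \<Omega> \<rho> n (transform f) (transform (kernel_density w))"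
proof -
  have eq: "exp (\<i> * pairing w \<xi>) * f \<xi> = f \<xi> * cnj (kernel_density w \<xi>) * complex_of_real (wt \<xi>)" for \<xi>
    using weight_ge_1[of \<xi>] by (simp add: kernel_density_def)
  show ?thesis
    unfolding HS_inner_transform[OF assms(1) kernel_density_mem[OF assms(2)]]
    using assms(2) by (simp only: transform_def Laplace_def eq if_True)
qed

sublocale reproducing_kernel_space "tube \<Omega>" "HS \<Omega> \<rho> n" "HS_inner \<Omega> \<rho> n" "\<lambda>w. transform (kernel_density w)"
proof
  let ?V = "HS \<Omega> \<rho> n" and ?ip = "HS_inner \<Omega> \<rho> n"
  show "(\<lambda>x. 0) \<in> ?V" using transform_mem[OF L2_zero] by (simp add: transform_zero)
  show "(\<lambda>x. F x + G x) \<in> ?V" if FG: "F \<in> ?V" "G \<in> ?V" for F G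
  proof -
    obtain f where f: "f \<in> L2" "F = transform f" using FG(1) by (rule HS_cases)
    obtain g where g: "g \<in> L2" "G = transform g" using FG(2) by (rule HS_cases)
    show ?thesis
      using transform_mem[OF L2_add[OF f(1) g(1)]] unfolding f(2) g(2) transform_add[OF f(1) g(1)] .
  qed
  show "(\<lambda>x. c * F x) \<in> ?V" if F: "F \<in> ?V" for c F
  proof -
    obtain f where f: "f \<in> L2" "F = transform f" using F by (rule HS_cases)
    show ?thesis using transform_mem[OF L2_scale[OF f(1)]] unfolding f(2) transform_scale .
  qed
  show "?ip (\<lambda>x. F x + G x) H = ?ip F H + ?ip G H" if FGH: "F \<in> ?V" "G \<in> ?V" "H \<in> ?V" for F G H
  proof -
    obtain f where f: "f \<in> L2" "F = transform f" using FGH(1) by (rule HS_cases)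
    obtain g where g: "g \<in> L2" "G = transform g" using FGH(2) by (rule HS_cases)
    obtain h where h: "h \<in> L2" "H = transform h" using FGH(3) by (rule HS_cases)
    show ?thesis
      unfolding f(2) g(2) h(2) transform_add[OF f(1) g(1), symmetric]
        HS_inner_transform[OF f(1) h(1)] HS_inner_transform[OF g(1) h(1)]
        HS_inner_transform[OF L2_add[OF f(1) g(1)] h(1)] distrib_right
      by (intro Bochner_Integration.integral_add L2_product_integrable f g h)
  qed
  show "?ip (\<lambda>x. c * F x) H = c * ?ip F H" if FH: "F \<in> ?V" "H \<in> ?V" for c F H
  proof -
    obtain f where f: "f \<in> L2" "F = transform f" using FH(1) by (rule HS_cases)
    obtain h where h: "h \<in> L2" "H = transform h" using FH(2) by (rule HS_cases)
    show ?thesis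
      unfolding f(2) h(2) transform_scale[symmetric] HS_inner_transform[OF f(1) h(1)]
        HS_inner_transform[OF L2_scale[OF f(1)] h(1)] mult.assoc
      by simp
  qed
  show "?ip G F = cnj (?ip F G)" if FG: "F \<in> ?V" "G \<in> ?V" for F G
  proof -
    obtain f where f: "f \<in> L2" "F = transform f" using FG(1) by (rule HS_cases)
    obtain g where g: "g \<in> L2" "G = transform g" using FG(2) by (rule HS_cases)
    have "cnj (LINT \<xi>|M. f \<xi> * cnj (g \<xi>) * complex_of_real (wt \<xi>))
        = (LINT \<xi>|M. cnj (f \<xi> * cnj (g \<xi>) * complex_of_real (wt \<xi>)))"
      by (rule Bochner_Integration.integral_cnj[symmetric])
    then show ?thesis
      unfolding f(2) g(2) HS_inner_transform[OF f(1) g(1)] HS_inner_transform[OF g(1) f(1)]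
      by (simp add: mult_ac)
  qed
  show "0 \<le> Re (?ip F F)" if F: "F \<in> ?V" for F
  proof -
    obtain f where f: "f \<in> L2" "F = transform f" using F by (rule HS_cases)
    have "0 \<le> (LINT \<xi>|M. (cmod (f \<xi>))\<^sup>2 * wt \<xi>)"
      by (intro integral_nonneg_AE AE_I2) (simp add: weight_nonneg)
    then show ?thesis using f by (simp add: HS_inner_self_transform)
  qed
  show "F x = 0" if "F \<in> ?V" "x \<notin> tube \<Omega>" for F x using that by (simp add: HS_def)
  show "transform (kernel_density w) \<in> ?V" if "w \<in> tube \<Omega>" for w
    by (intro transform_mem kernel_density_mem that)
  show "F w = ?ip F (transform (kernel_density w))" if w: "w \<in> tube \<Omega>" and F: "F \<in> ?V" for w F
  proof -
    obtain f where f: "f \<in> L2" "F = transform f" using F by (rule HS_cases)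
    then show ?thesis using transform_eq_inner_kernel[OF f(1) w] by simp
  qed
  show "\<exists>G\<in>?V. (\<lambda>k. sqrt (Re (?ip (\<lambda>x. F k x - G x) (\<lambda>x. F k x - G x)))) \<longlonglongrightarrow> 0"
    if F: "\<And>k. F k \<in> ?V"
      and incr: "\<And>k. sqrt (Re (?ip (\<lambda>x. F (Suc k) x - F k x) (\<lambda>x. F (Suc k) x - F k x))) \<le> C * (1/2) ^ k"
    for F C
  proof -
    have "\<forall>k. \<exists>f. f \<in> L2 \<and> F k = transform f" using HS_cases[OF F] by blast
    then obtain f where f: "\<And>k. f k \<in> L2" "\<And>k. F k = transform (f k)" by metis
    have sq: "Re (?ip (\<lambda>x. F k x - transform g x) (\<lambda>x. F k x - transform g x))
        = (LINT \<xi>|M. (cmod (f k \<xi> - g \<xi>))\<^sup>2 * wt \<xi>)" if g: "g \<in> L2" for k g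
      unfolding f(2) transform_diff[OF f(1) g, symmetric]
      by (rule HS_inner_self_transform[OF L2_diff[OF f(1) g]])
    have "(LINT \<xi>|M. (cmod (f (Suc k) \<xi> - f k \<xi>))\<^sup>2 * wt \<xi>) \<le> (C * (1/2) ^ k)\<^sup>2" for k
      using incr[of k] sq[OF f(1)[of k], of "Suc k"] unfolding f(2)[of k, symmetric]
      by (simp add: sqrt_le_D)
    from L2_complete[OF f(1) this] obtain g where
      g: "g \<in> L2" "(\<lambda>k. LINT \<xi>|M. (cmod (f k \<xi> - g \<xi>))\<^sup>2 * wt \<xi>) \<longlonglongrightarrow> 0" .
    have "(\<lambda>k. sqrt (LINT \<xi>|M. (cmod (f k \<xi> - g \<xi>))\<^sup>2 * wt \<xi>)) \<longlonglongrightarrow> 0"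
      using tendsto_real_sqrt[OF g(2)] by simp
    then show ?thesis using transform_mem[OF g(1)] by (intro bexI[of _ "transform g"]) (simp_all add: sq[OF g(1)])
  qed
qed

lemma HS_norm_eq_nm: "HS_norm \<Omega> \<rho> n F = nm F"
  by (simp add: HS_norm_def nm_def)

lemma HS_kernel_eq:
  assumes w: "w \<in> tube \<Omega>"
  shows "HS_kernel \<Omega> \<rho> n w = transform (kernel_density w)"
  unfolding HS_kernel_def
proof (rule the_equality)
  show "transform (kernel_density w) \<in> HS \<Omega> \<rho> n \<and>
      (\<forall>F\<in>HS \<Omega> \<rho> n. F w = HS_inner \<Omega> \<rho> n F (transform (kernel_density w)))"
    using kernel_mem[OF w] reproducing[OF w] by blast
  fix K assume K: "K \<in> HS \<Omega> \<rho> n \<and> (\<forall>F\<in>HS \<Omega> \<rho> n. F w = HS_inner \<Omega> \<rho> n F K)"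
  show "K = transform (kernel_density w)"
  proof (rule ip_ext)
    show "HS_inner \<Omega> \<rho> n F K = HS_inner \<Omega> \<rho> n F (transform (kernel_density w))" if "F \<in> HS \<Omega> \<rho> n" for F
      using K that reproducing[OF w that] by simp
  qed (use K kernel_mem[OF w] in auto)
qed

text \<open>The kernel density has no zeros, so its norm can only vanish if the dual cone is a null set.\<close>

lemma kernel_norm_pos:
  assumes w: "w \<in> tube \<Omega>"
  shows "nm (transform (kernel_density w)) > 0"
proof (rule ccontr)
  let ?k = "kernel_density w"
  have k: "?k \<in> L2" by (rule kernel_density_mem[OF w])
  assume "\<not> nm (transform ?k) > 0"
  then have "nm (transform ?k) = 0" using nm_nonneg[OF kernel_mem[OF w]] by simp
  then have "(LINT \<xi>|M. (cmod (?k \<xi>))\<^sup>2 * wt \<xi>) = 0"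
    using HS_inner_self_transform[OF k] by (simp add: nm_def)
  then have "AE \<xi> in M. (cmod (?k \<xi>))\<^sup>2 * wt \<xi> = 0"
    by (subst (asm) integral_nonneg_eq_0_iff_AE[OF L2_integrable[OF k]]) (simp_all add: weight_nonneg)
  then have "AE \<xi> in M. False"
  proof eventually_elim
    case (elim \<xi>)
    then show ?case using weight_ge_1[of \<xi>] by (simp add: kernel_density_def)
  qed
  then have "AE \<xi> in lebesgue. \<xi> \<notin> dual_cone \<Omega>"
    by (simp add: AE_restrict_space_iff)
  then have "dual_cone \<Omega> \<in> null_sets lebesgue" by (simp add: AE_iff_null_sets)
  then show False
    using dual_cone_not_negligible[OF cone no_line] by (simp add: negligible_iff_null_sets)
qed

section \<open>Multipliers of the Hardy--Sobolev space\<close>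

lemma multiplier_mult_mem:
  assumes "\<psi> \<in> multipliers \<Omega> \<rho> n" "F \<in> HS \<Omega> \<rho> n"
  shows "(\<lambda>z. \<psi> z * F z) \<in> HS \<Omega> \<rho> n"
proof -
  have "\<forall>F\<in>HS \<Omega> \<rho> n. mult_op \<psi> F \<in> HS \<Omega> \<rho> n" using assms(1) by (simp add: multipliers_def)
  from bspec[OF this assms(2)] show ?thesis by (simp only: mult_op_def)
qed

lemma HS_adjoint_multiplier_kernel:
  assumes "\<psi> \<in> multipliers \<Omega> \<rho> n" and w: "w \<in> tube \<Omega>"
  shows "HS_adjoint \<Omega> \<rho> n (mult_op \<psi>) (HS_kernel \<Omega> \<rho> n w) = (\<lambda>z. cnj (\<psi> w) * HS_kernel \<Omega> \<rho> n w z)"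
  unfolding HS_adjoint_def HS_kernel_eq[OF w]
proof (rule the_equality)
  let ?K = "transform (kernel_density w)"
  have \<psi>: "(\<lambda>z. \<psi> z * F z) \<in> HS \<Omega> \<rho> n" if "F \<in> HS \<Omega> \<rho> n" for F
    by (rule multiplier_mult_mem[OF assms(1) that])
  have cK: "(\<lambda>z. cnj (\<psi> w) * ?K z) \<in> HS \<Omega> \<rho> n" by (rule scale_mem[OF kernel_mem[OF w]])
  have adj: "HS_inner \<Omega> \<rho> n (mult_op \<psi> F) ?K = HS_inner \<Omega> \<rho> n F (\<lambda>z. cnj (\<psi> w) * ?K z)"
    if "F \<in> HS \<Omega> \<rho> n" for F
    unfolding mult_op_def using adjoint_kernel[OF \<psi> w that] .
  then show "(\<lambda>z. cnj (\<psi> w) * ?K z) \<in> HS \<Omega> \<rho> n \<and>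
      (\<forall>F\<in>HS \<Omega> \<rho> n. HS_inner \<Omega> \<rho> n (mult_op \<psi> F) ?K = HS_inner \<Omega> \<rho> n F (\<lambda>z. cnj (\<psi> w) * ?K z))"
    using cK by blast
  fix H assume "H \<in> HS \<Omega> \<rho> n \<and> (\<forall>F\<in>HS \<Omega> \<rho> n. HS_inner \<Omega> \<rho> n (mult_op \<psi> F) ?K = HS_inner \<Omega> \<rho> n F H)"
  then show "H = (\<lambda>z. cnj (\<psi> w) * ?K z)" using cK adj by (intro ip_ext) auto
qed

lemma HS_bounded_operator_multiplier:
  assumes "\<psi> \<in> multipliers \<Omega> \<rho> n"
  shows "HS_bounded_operator \<Omega> \<rho> n (mult_op \<psi>)"
proof -
  have \<psi>: "(\<lambda>z. \<psi> z * F z) \<in> HS \<Omega> \<rho> n" if "F \<in> HS \<Omega> \<rho> n" for F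
    by (rule multiplier_mult_mem[OF assms that])
  show ?thesis
    unfolding HS_bounded_operator_def mult_op_def HS_norm_eq_nm
    using \<psi> multiplier_bounded[OF \<psi>] by (simp add: algebra_simps)
qed

lemma multiplier_le_opnorm:
  assumes "\<psi> \<in> multipliers \<Omega> \<rho> n" and w: "w \<in> tube \<Omega>"
  shows "cmod (\<psi> w) \<le> HS_opnorm \<Omega> \<rho> n (mult_op \<psi>)"
proof -
  let ?K = "transform (kernel_density w)"
  have \<psi>: "(\<lambda>z. \<psi> z * F z) \<in> HS \<Omega> \<rho> n" if "F \<in> HS \<Omega> \<rho> n" for F
    by (rule multiplier_mult_mem[OF assms(1) that])
  have K: "?K \<in> HS \<Omega> \<rho> n" "nm ?K > 0" by (rule kernel_mem[OF w], rule kernel_norm_pos[OF w])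
  define F where "F = (\<lambda>z. complex_of_real (1 / nm ?K) * ?K z)"
  have F: "F \<in> HS \<Omega> \<rho> n" unfolding F_def by (rule scale_mem[OF K(1)])
  have F1: "nm F = 1" unfolding F_def using nm_scale[OF K(1), of "complex_of_real (1 / nm ?K)"] K(2)
    by (simp add: norm_divide)
  obtain C where C: "\<And>F. F \<in> HS \<Omega> \<rho> n \<Longrightarrow> nm (\<lambda>z. \<psi> z * F z) \<le> C * nm F"
    using multiplier_bounded[OF \<psi>] by blast
  have bdd: "bdd_above ((\<lambda>F. HS_norm \<Omega> \<rho> n (mult_op \<psi> F)) ` {F \<in> HS \<Omega> \<rho> n. HS_norm \<Omega> \<rho> n F \<le> 1})"
  proof (rule bdd_aboveI2)
    fix F assume "F \<in> {F \<in> HS \<Omega> \<rho> n. HS_norm \<Omega> \<rho> n F \<le> 1}"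
    then have F: "F \<in> HS \<Omega> \<rho> n" "nm F \<le> 1" by (auto simp: HS_norm_eq_nm)
    have "nm (\<lambda>z. \<psi> z * F z) \<le> C * nm F" by (rule C[OF F(1)])
    also have "\<dots> \<le> \<bar>C\<bar> * nm F" using nm_nonneg[OF F(1)] by (intro mult_right_mono) auto
    also have "\<dots> \<le> \<bar>C\<bar> * 1" using F(2) by (intro mult_left_mono) auto
    finally show "HS_norm \<Omega> \<rho> n (mult_op \<psi> F) \<le> \<bar>C\<bar>" by (simp add: HS_norm_eq_nm mult_op_def)
  qed
  have "(\<lambda>z. \<psi> z * F z) = (\<lambda>z. complex_of_real (1 / nm ?K) * (\<psi> z * ?K z))"
    by (simp add: F_def mult_ac)
  then have "nm (\<lambda>z. \<psi> z * F z) = (1 / nm ?K) * nm (\<lambda>z. \<psi> z * ?K z)"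
    using nm_scale[OF \<psi>[OF K(1)], of "complex_of_real (1 / nm ?K)"] K(2)
    by (simp add: norm_divide)
  moreover have "cmod (\<psi> w) * nm ?K \<le> nm (\<lambda>z. \<psi> z * ?K z)" by (rule multiplier_value_le[OF \<psi> w])
  ultimately have "cmod (\<psi> w) * nm ?K \<le> nm (\<lambda>z. \<psi> z * F z) * nm ?K" using K(2) by simp
  then have "cmod (\<psi> w) \<le> nm (\<lambda>z. \<psi> z * F z)" using K(2) by simp
  also have "\<dots> = HS_norm \<Omega> \<rho> n (mult_op \<psi> F)" by (simp only: HS_norm_eq_nm mult_op_def)
  also have "\<dots> \<le> HS_opnorm \<Omega> \<rho> n (mult_op \<psi>)"
    unfolding HS_opnorm_def using F F1 by (intro cSUP_upper bdd) (simp add: HS_norm_eq_nm)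
  finally show ?thesis .
qed

end

theorem proposition8p2:
  fixes \<Omega> :: "(real ^ 'd) set" and \<rho> :: "real ^ 'd \<Rightarrow> real" and n :: nat
    and \<psi> :: "complex ^ 'd \<Rightarrow> complex"
  assumes "open_convex_cone \<Omega>"
    and "\<not> contains_line \<Omega>"
    and "continuous_on (dual_cone \<Omega>) \<rho>"
    and "\<forall>\<xi>\<in>dual_cone \<Omega>. 0 \<le> \<rho> \<xi>"
    and "\<forall>\<xi>\<in>dual_cone \<Omega>. \<xi> \<noteq> 0 \<longrightarrow> 0 < \<rho> \<xi>"
    and "\<forall>\<xi>\<in>dual_cone \<Omega>. \<forall>t>0. \<rho> (t *\<^sub>R \<xi>) = t * \<rho> \<xi>"
    and "\<psi> \<in> multipliers \<Omega> \<rho> n"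
  shows "HS_bounded_operator \<Omega> \<rho> n (mult_op \<psi>) \<and>
    (\<forall>w\<in>tube \<Omega>. HS_adjoint \<Omega> \<rho> n (mult_op \<psi>) (HS_kernel \<Omega> \<rho> n w)
       = (\<lambda>z. cnj (\<psi> w) * HS_kernel \<Omega> \<rho> n w z)) \<and>
    (\<forall>w\<in>tube \<Omega>. cmod (\<psi> w) \<le> HS_opnorm \<Omega> \<rho> n (mult_op \<psi>)) \<and>
    \<psi> \<in> Hinf \<Omega> \<and> Hinf_norm \<Omega> \<psi> \<le> HS_opnorm \<Omega> \<rho> n (mult_op \<psi>)"
proof -
  interpret weighted_cone \<Omega> \<rho> n
    using assms(1,2,3) by unfold_locales
  have le: "cmod (\<psi> w) \<le> HS_opnorm \<Omega> \<rho> n (mult_op \<psi>)" if "w \<in> tube \<Omega>" for w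
    by (rule multiplier_le_opnorm[OF assms(7) that])
  obtain y where "y \<in> \<Omega>" using nonempty_\<Omega> by blast
  then have "(\<chi> j. \<i> * complex_of_real (y $ j)) \<in> tube \<Omega>" by (simp add: tube_def)
  then have "tube \<Omega> \<noteq> {}" by blast
  then have "Hinf_norm \<Omega> \<psi> \<le> HS_opnorm \<Omega> \<rho> n (mult_op \<psi>)"
    unfolding Hinf_norm_def using le by (rule cSUP_least)
  moreover have "\<psi> \<in> Hinf \<Omega>"
    using assms(7) le by (auto simp: Hinf_def multipliers_def bounded_iff)
  ultimately show ?thesis
    using le HS_bounded_operator_multiplier[OF assms(7)] HS_adjoint_multiplier_kernel[OF assms(7)] by blast
qed

end
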